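(* Assume that $\Omega$ is convex and $u_0\in C(\overline{\Omega})$. Fix $t\ge 0$ and $\vec{x}_0\in\overline{\Omega}$. For each sufficiently small $h>0$ let $r_h\in\mathbb{R}$ satisfy $|r_h|<h$ and let $\beta_h\in\mathbb{R}$ satisfy $\max\{\omega_0(|\beta_h|),|\beta_h|\}\le h$, where $\omega_0$ is the modulus of continuity described in the context. Let $w$ be the solution of the Neumann problem (HJE) of the context with initial condition $w_0(\alpha)=u_0(\vec{x}_0+\alpha\vec{\nu})$, $\alpha\in[a,b]$, and let $w^{\beta_h}_{r_h,h}$ be the solution of the discrete problem (D$_{\beta,r,h}$) of the context with $\beta=\beta_h$, $r=r_h$, whose initial condition is $w_0^{\beta_h}(x)=u_0(\vec{x}_0+\beta_h\vec{\nu}_\perp+x\vec{\nu})$ for $x\in\tilde{\Omega}_{\beta_h,r_h,h}$. Assume that $r_h+k_hh\in\tilde{\Omega}_{\beta_h,r_h,h}$ for some $k_h\in\mathbb{Z}$ with $\lim_{h\to0^+}k_hh=\alpha_0$ for some $\alpha_0\in[a,b]$. Then $$\lim_{h\to0^+}w^{\beta_h}_{r_h,h}(r_h+k_hh,t)=w(\alpha_0,t).$$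
   Context: Setting. $\mathbb{R}^2_+=\{x\in\mathbb{R}^2:x_1>0,x_2>0\}$, and $\Omega\subset\mathbb{R}^2_+$ is a bounded open domain with $\overline{\Omega}\subset\mathbb{R}^2_+$. The reaction vector is $\vec{\nu}=(-\nu^+_{11},\nu^-_{12})$ with nonnegative integers $\nu^+_{11},\nu^-_{12}$ not both zero, and $\vec{\nu}_\perp=(\nu^-_{12},\nu^+_{11})$, so that $\vec{\nu}\cdot\vec{\nu}_\perp=0$. The intensities $\Phi^\pm:\overline{\Omega}\to\mathbb{R}$ are continuous with $\Phi^\pm\ge c_0>0$. Segments. For $\beta\in\mathbb{R}$ with $S_\beta:=\{\vec{x}_0+\beta\vec{\nu}_\perp+\alpha\vec{\nu}:\alpha\in\mathbb{R}\}\cap\overline{\Omega}\neq\emptyset$, write $S_\beta=\{\vec{x}_0+\beta\vec{\nu}_\perp+\alpha\vec{\nu}:a_\beta\le\alpha\le b_\beta\}$ (a segment by convexity). Put $a=a_0$, $b=b_0$, $S_0=\{\vec{x}_0+\alpha\vec{\nu}:a\le\alpha\le b\}$. Since $\Omega$ is convex there is a modulus of continuity $\omega_0$ (continuous nondecreasing $\omega_0:[0,\infty)\to[0,\infty)$, $\omega_0(0)=0$) with $|a_\beta-a|\le\omega_0(|\beta|)$ and $|b_\beta-b|\le\omega_0(|\beta|)$ for all small $\beta$ with $S_\beta\ne\emptyset$; one such $\omega_0$ is fixed. Discrete problem (D$_{\beta,r,h}$). Let $\tilde{\Omega}_{\beta,r,h}=\{r+kh:k\in\mathbb{Z},\ a_\beta\le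 r+kh\le b_\beta\}$ and $\tilde{\Phi}^\pm_\beta(\alpha)=\Phi^\pm(\vec{x}_0+\beta\vec{\nu}_\perp+\alpha\vec{\nu})$. The function $w^\beta_{r,h}:\tilde{\Omega}_{\beta,r,h}\times[0,\infty)\to\mathbb{R}$ is the unique solution of the system, for $x\in\tilde{\Omega}_{\beta,r,h}$, $t>0$, $$\partial_tw^\beta_{r,h}(x,t)=\mathbb{1}_{\{x+h\in\tilde{\Omega}_{\beta,r,h}\}}\tilde{\Phi}^+_\beta(x)\Big(e^{\frac{w^\beta_{r,h}(x+h,t)-w^\beta_{r,h}(x,t)}{h}}-1\Big)+\mathbb{1}_{\{x-h\in\tilde{\Omega}_{\beta,r,h}\}}\tilde{\Phi}^-_\beta(x)\Big(e^{\frac{w^\beta_{r,h}(x-h,t)-w^\beta_{r,h}(x,t)}{h}}-1\Big),$$ with $w^\beta_{r,h}(x,0)=u_0(\vec{x}_0+\beta\vec{\nu}_\perp+x\vec{\nu})$. Continuous problem (HJE). Let $\tilde{\Phi}^\pm(\alpha)=\Phi^\pm(\vec{x}_0+\alpha\vec{\nu})$ and $\tilde{H}(\alpha,p)=\tilde{\Phi}^+(\alpha)(e^p-1)+\tilde{\Phi}^-(\alpha)(e^{-p}-1)$ for $\alpha\in[a,b]$. When $a<b$, (HJE) is $$\partial_tw=\tilde{H}(\alpha,\partial_\alpha w)\ \text{in }(a,b)\times(0,\infty),\quad-\partial_\alpha w(a,t)=\partial_\alpha w(b,t)=0\ (t>0),\quad w(\cdot,0)=w_0\ \text{on }[a,b],$$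 understood in the viscosity sense. An upper semicontinuous $v$ on $[a,b]\times[0,\infty)$ is a subsolution if $v(\cdot,0)\le w_0$ and, whenever $\varphi\in C^1$ and $v-\varphi$ has a local maximum at $(\alpha_0,t_0)$ with $t_0>0$: $\partial_t\varphi-\tilde{H}(\alpha_0,\partial_\alpha\varphi)\le0$ at $(\alpha_0,t_0)$ if $\alpha_0\in(a,b)$; $\min\{\partial_t\varphi-\tilde{H}(a,\partial_\alpha\varphi),-\partial_\alpha\varphi\}\le0$ if $\alpha_0=a$; $\min\{\partial_t\varphi-\tilde{H}(b,\partial_\alpha\varphi),\partial_\alpha\varphi\}\le0$ if $\alpha_0=b$. A lower semicontinuous $v$ is a supersolution if $v(\cdot,0)\ge w_0$ and the corresponding conditions hold at local minima with $\le$ replaced by $\ge$ and $\min$ by $\max$. A solution is a continuous function that is both; it is unique. If $a=b$ (so $a=b=0$), the convention is $w(0,t)=w_0(0)=u_0(\vec{x}_0)$. *)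

theory Defs
  imports "HOL-Analysis.Analysis"
begin

definition positive_quadrant :: "(real^2) set"
  where "positive_quadrant = {x. x $ 1 > 0 \<and> x $ 2 > 0}"

definition reaction_vec :: "nat \<Rightarrow> nat \<Rightarrow> real^2"
  where "reaction_vec m n = vector [- real m, real n]"

definition reaction_perp :: "nat \<Rightarrow> nat \<Rightarrow> real^2"
  where "reaction_perp m n = vector [real n, real m]"

lemma reaction_vec_orthogonal: "reaction_vec m n \<bullet> reaction_perp m n = 0"
  by (simp add: reaction_vec_def reaction_perp_def inner_vec_def sum_2)

lemma reaction_vec_nonzero: "m \<noteq> 0 \<or> n \<noteq> 0 \<Longrightarrow> reaction_vec m n \<noteq> 0"
  by (auto simp: reaction_vec_def vec_eq_iff forall_2)


section \<open>Segments\<close>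

definition line_pt :: "real^2 \<Rightarrow> nat \<Rightarrow> nat \<Rightarrow> real \<Rightarrow> real \<Rightarrow> real^2"
  where "line_pt x0 m n \<beta> \<alpha> = x0 + \<beta> *\<^sub>R reaction_perp m n + \<alpha> *\<^sub>R reaction_vec m n"

definition seg :: "(real^2) set \<Rightarrow> real^2 \<Rightarrow> nat \<Rightarrow> nat \<Rightarrow> real \<Rightarrow> (real^2) set"
  where "seg \<Omega> x0 m n \<beta> = range (line_pt x0 m n \<beta>) \<inter> closure \<Omega>"

text \<open>The endpoints are meaningful only when \<open>seg \<Omega> x0 m n \<beta>\<close> is nonempty; see \<open>seg_eq\<close> below.\<close>

definition seg_lo :: "(real^2) set \<Rightarrow> real^2 \<Rightarrow> nat \<Rightarrow> nat \<Rightarrow> real \<Rightarrow> real"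
  where "seg_lo \<Omega> x0 m n \<beta> = Inf {\<alpha>. line_pt x0 m n \<beta> \<alpha> \<in> closure \<Omega>}"

definition seg_hi :: "(real^2) set \<Rightarrow> real^2 \<Rightarrow> nat \<Rightarrow> nat \<Rightarrow> real \<Rightarrow> real"
  where "seg_hi \<Omega> x0 m n \<beta> = Sup {\<alpha>. line_pt x0 m n \<beta> \<alpha> \<in> closure \<Omega>}"

lemma seg_params_eq:
  assumes "convex \<Omega>" "bounded \<Omega>" "m \<noteq> 0 \<or> n \<noteq> 0" "seg \<Omega> x0 m n \<beta> \<noteq> {}"
  shows "seg_lo \<Omega> x0 m n \<beta> \<le> seg_hi \<Omega> x0 m n \<beta>"
    and "{\<alpha>. line_pt x0 m n \<beta> \<alpha> \<in> closure \<Omega>} = {seg_lo \<Omega> x0 m n \<beta> .. seg_hi \<Omega> x0 m n \<beta>}"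
proof -
  define A where "A = {\<alpha>. line_pt x0 m n \<beta> \<alpha> \<in> closure \<Omega>}"
  have ne: "A \<noteq> {}"
    using assms(4) by (auto simp: A_def seg_def)
  have cont: "continuous_on UNIV (line_pt x0 m n \<beta>)"
    unfolding line_pt_def by (intro continuous_intros)
  have cl: "closed A"
    using continuous_closed_preimage[OF cont closed_UNIV closed_closure[of \<Omega>]]
    by (simp add: A_def vimage_def)
  have "is_interval A"
    unfolding is_interval_convex_1
  proof (rule convexI)
    fix s t u v :: real
    assume st: "s \<in> A" "t \<in> A" and uv: "0 \<le> u" "0 \<le> v" "u + v = 1"
    have "u *\<^sub>R line_pt x0 m n \<beta> s + v *\<^sub>R line_pt x0 m n \<beta> t \<in> closure \<Omega>"
      using convex_closure[OF assms(1)] st uv by (intro convexD) (auto simp: A_def)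
    also have "u *\<^sub>R line_pt x0 m n \<beta> s + v *\<^sub>R line_pt x0 m n \<beta> t
        = (u + v) *\<^sub>R (x0 + \<beta> *\<^sub>R reaction_perp m n) + (u * s + v * t) *\<^sub>R reaction_vec m n"
      by (simp add: line_pt_def algebra_simps)
    also have "\<dots> = line_pt x0 m n \<beta> (u *\<^sub>R s + v *\<^sub>R t)"
      using uv by (simp add: line_pt_def)
    finally show "u *\<^sub>R s + v *\<^sub>R t \<in> A" by (simp add: A_def)
  qed
  moreover have "bounded A"
  proof -
    obtain B where B: "\<And>x. x \<in> closure \<Omega> \<Longrightarrow> norm x \<le> B"
      using bounded_closure[OF assms(2)] by (auto simp: bounded_iff)
    let ?p = "x0 + \<beta> *\<^sub>R reaction_perp m n" and ?v = "reaction_vec m n"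
    have "norm s \<le> (B + norm ?p) / norm ?v" if "s \<in> A" for s
    proof -
      have "norm (s *\<^sub>R ?v) = norm (line_pt x0 m n \<beta> s - ?p)"
        by (simp add: line_pt_def)
      also have "\<dots> \<le> B + norm ?p"
        using B[of "line_pt x0 m n \<beta> s"] that norm_triangle_ineq4[of "line_pt x0 m n \<beta> s" ?p]
        by (simp add: A_def)
      finally show ?thesis
        using reaction_vec_nonzero[OF assms(3)] by (simp add: pos_le_divide_eq)
    qed
    then show ?thesis by (auto simp: bounded_iff)
  qed
  moreover have bdd: "bdd_below A" "bdd_above A"
    using \<open>bounded A\<close> by (simp_all add: bounded_imp_bdd_below bounded_imp_bdd_above)
  moreover have "Inf A \<in> A" "Sup A \<in> A"
    using closed_contains_Inf[OF ne bdd(1) cl] closed_contains_Sup[OF ne bdd(2) cl] by blast+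
  ultimately have "A = {Inf A .. Sup A}" "Inf A \<le> Sup A"
    unfolding is_interval_1 by (meson cInf_lower cSup_upper atLeastAtMost_iff subset_antisym subsetI)+
  then show "seg_lo \<Omega> x0 m n \<beta> \<le> seg_hi \<Omega> x0 m n \<beta>"
    and "{\<alpha>. line_pt x0 m n \<beta> \<alpha> \<in> closure \<Omega>} = {seg_lo \<Omega> x0 m n \<beta> .. seg_hi \<Omega> x0 m n \<beta>}"
    by (simp_all add: A_def seg_lo_def seg_hi_def)
qed

lemma seg_eq:
  assumes "convex \<Omega>" "bounded \<Omega>" "m \<noteq> 0 \<or> n \<noteq> 0" "seg \<Omega> x0 m n \<beta> \<noteq> {}"
  shows "seg \<Omega> x0 m n \<beta> = line_pt x0 m n \<beta> ` {seg_lo \<Omega> x0 m n \<beta> .. seg_hi \<Omega> x0 m n \<beta>}"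
  using seg_params_eq(2)[OF assms] by (auto simp: seg_def)

definition modulus :: "(real \<Rightarrow> real) \<Rightarrow> bool"
  where "modulus \<omega> \<longleftrightarrow>
    continuous_on {0..} \<omega> \<and> mono_on {0..} \<omega> \<and> (\<forall>s\<ge>0. 0 \<le> \<omega> s) \<and> \<omega> 0 = 0"


section \<open>The discrete problem\<close>

definition grid :: "real \<Rightarrow> real \<Rightarrow> real \<Rightarrow> real \<Rightarrow> real set"
  where "grid a b r h = {x. (\<exists>k::int. x = r + of_int k * h) \<and> a \<le> x \<and> x \<le> b}"

text \<open>Continuity down to time 0 is what links the initial value to the equation, which is
  imposed for positive times only.\<close>

definition discrete_solution ::
  "real set \<Rightarrow> real \<Rightarrow> (real \<Rightarrow> real) \<Rightarrow> (real \<Rightarrow> real) \<Rightarrow> (real \<Rightarrow> real) \<Rightarrow> (real \<Rightarrow> real \<Rightarrow> real) \<Rightarrow> bool"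
  where "discrete_solution G h \<Phi>p \<Phi>m w0 w \<longleftrightarrow>
    (\<forall>x\<in>G. continuous_on {0..} (w x) \<and> w x 0 = w0 x \<and>
      (\<forall>t>0. (w x has_real_derivative
          (indicator G (x + h) * \<Phi>p x * (exp ((w (x + h) t - w x t) / h) - 1) +
           indicator G (x - h) * \<Phi>m x * (exp ((w (x - h) t - w x t) / h) - 1))) (at t)))"


section \<open>The Neumann problem\<close>

definition hamiltonian :: "(real \<Rightarrow> real) \<Rightarrow> (real \<Rightarrow> real) \<Rightarrow> real \<Rightarrow> real \<Rightarrow> real"
  where "hamiltonian \<Phi>p \<Phi>m \<alpha> p = \<Phi>p \<alpha> * (exp p - 1) + \<Phi>m \<alpha> * (exp (- p) - 1)"

definition usc_on :: "'a::topological_space set \<Rightarrow> ('a \<Rightarrow> real) \<Rightarrow> bool"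
  where "usc_on S f \<longleftrightarrow> (\<forall>x\<in>S. \<forall>\<epsilon>>0. \<forall>\<^sub>F y in at x within S. f y < f x + \<epsilon>)"

definition lsc_on :: "'a::topological_space set \<Rightarrow> ('a \<Rightarrow> real) \<Rightarrow> bool"
  where "lsc_on S f \<longleftrightarrow> (\<forall>x\<in>S. \<forall>\<epsilon>>0. \<forall>\<^sub>F y in at x within S. f x - \<epsilon> < f y)"

definition local_max_on :: "'a::topological_space set \<Rightarrow> ('a \<Rightarrow> real) \<Rightarrow> 'a \<Rightarrow> bool"
  where "local_max_on S f x \<longleftrightarrow> (\<forall>\<^sub>F y in at x within S. f y \<le> f x)"

definition local_min_on :: "'a::topological_space set \<Rightarrow> ('a \<Rightarrow> real) \<Rightarrow> 'a \<Rightarrow> bool"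
  where "local_min_on S f x \<longleftrightarrow> (\<forall>\<^sub>F y in at x within S. f x \<le> f y)"

text \<open>\<open>C1_partials \<phi> \<phi>\<alpha> \<phi>t\<close>: the function \<open>\<phi>\<close> of \<open>(\<alpha>, t)\<close> is continuously differentiable on the
  plane with partial derivatives \<open>\<phi>\<alpha>\<close> and \<open>\<phi>t\<close>.\<close>

definition C1_partials ::
  "(real \<times> real \<Rightarrow> real) \<Rightarrow> (real \<times> real \<Rightarrow> real) \<Rightarrow> (real \<times> real \<Rightarrow> real) \<Rightarrow> bool"
  where "C1_partials \<phi> \<phi>\<alpha> \<phi>t \<longleftrightarrow>
    (\<forall>z. (\<phi> has_derivative (\<lambda>v. \<phi>\<alpha> z * fst v + \<phi>t z * snd v)) (at z)) \<and>
    continuous_on UNIV \<phi>\<alpha> \<and> continuous_on UNIV \<phi>t"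

definition viscosity_subsolution ::
  "real \<Rightarrow> real \<Rightarrow> (real \<Rightarrow> real \<Rightarrow> real) \<Rightarrow> (real \<Rightarrow> real) \<Rightarrow> (real \<times> real \<Rightarrow> real) \<Rightarrow> bool"
  where "viscosity_subsolution a b H w0 v \<longleftrightarrow>
    usc_on ({a..b} \<times> {0..}) v \<and> (\<forall>\<alpha>\<in>{a..b}. v (\<alpha>, 0) \<le> w0 \<alpha>) \<and>
    (\<forall>\<phi> \<phi>\<alpha> \<phi>t \<alpha> t. C1_partials \<phi> \<phi>\<alpha> \<phi>t \<longrightarrow> \<alpha> \<in> {a..b} \<longrightarrow> t > 0 \<longrightarrow>
      local_max_on ({a..b} \<times> {0..}) (\<lambda>z. v z - \<phi> z) (\<alpha>, t) \<longrightarrow>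
        (\<alpha> \<in> {a<..<b} \<longrightarrow> \<phi>t (\<alpha>, t) - H \<alpha> (\<phi>\<alpha> (\<alpha>, t)) \<le> 0) \<and>
        (\<alpha> = a \<longrightarrow> min (\<phi>t (a, t) - H a (\<phi>\<alpha> (a, t))) (- \<phi>\<alpha> (a, t)) \<le> 0) \<and>
        (\<alpha> = b \<longrightarrow> min (\<phi>t (b, t) - H b (\<phi>\<alpha> (b, t))) (\<phi>\<alpha> (b, t)) \<le> 0))"

definition viscosity_supersolution ::
  "real \<Rightarrow> real \<Rightarrow> (real \<Rightarrow> real \<Rightarrow> real) \<Rightarrow> (real \<Rightarrow> real) \<Rightarrow> (real \<times> real \<Rightarrow> real) \<Rightarrow> bool"
  where "viscosity_supersolution a b H w0 v \<longleftrightarrow>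
    lsc_on ({a..b} \<times> {0..}) v \<and> (\<forall>\<alpha>\<in>{a..b}. v (\<alpha>, 0) \<ge> w0 \<alpha>) \<and>
    (\<forall>\<phi> \<phi>\<alpha> \<phi>t \<alpha> t. C1_partials \<phi> \<phi>\<alpha> \<phi>t \<longrightarrow> \<alpha> \<in> {a..b} \<longrightarrow> t > 0 \<longrightarrow>
      local_min_on ({a..b} \<times> {0..}) (\<lambda>z. v z - \<phi> z) (\<alpha>, t) \<longrightarrow>
        (\<alpha> \<in> {a<..<b} \<longrightarrow> \<phi>t (\<alpha>, t) - H \<alpha> (\<phi>\<alpha> (\<alpha>, t)) \<ge> 0) \<and>
        (\<alpha> = a \<longrightarrow> max (\<phi>t (a, t) - H a (\<phi>\<alpha> (a, t))) (- \<phi>\<alpha> (a, t)) \<ge> 0) \<and>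
        (\<alpha> = b \<longrightarrow> max (\<phi>t (b, t) - H b (\<phi>\<alpha> (b, t))) (\<phi>\<alpha> (b, t)) \<ge> 0))"

definition viscosity_solution ::
  "real \<Rightarrow> real \<Rightarrow> (real \<Rightarrow> real \<Rightarrow> real) \<Rightarrow> (real \<Rightarrow> real) \<Rightarrow> (real \<times> real \<Rightarrow> real) \<Rightarrow> bool"
  where "viscosity_solution a b H w0 w \<longleftrightarrow>
    continuous_on ({a..b} \<times> {0..}) w \<and>
    viscosity_subsolution a b H w0 w \<and> viscosity_supersolution a b H w0 w"

text \<open>A one-point interval is given the stationary solution by convention.\<close>

definition HJE_solution ::
  "real \<Rightarrow> real \<Rightarrow> (real \<Rightarrow> real) \<Rightarrow> (real \<Rightarrow> real) \<Rightarrow> (real \<Rightarrow> real) \<Rightarrow> (real \<times> real \<Rightarrow> real) \<Rightarrow> bool"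
  where "HJE_solution a b \<Phi>p \<Phi>m w0 w \<longleftrightarrow>
    (if a < b then viscosity_solution a b (hamiltonian \<Phi>p \<Phi>m) w0 w
     else \<forall>t\<ge>0. w (a, t) = w0 a)"

end

theory Submission
  imports Defs
begin

text \<open>
  The convergence is proved by doubling the variables between the discrete solution \<open>W\<close> and the
  viscosity solution \<open>w\<close> directly. For either sign \<open>k = 1\<close> or \<open>k = -1\<close>, look at a maximum point
  \<open>(x, t, y, s)\<close>, with \<open>x\<close> on the grid and \<open>y\<close> in the interval, of
  \<open>k W(x, t) - k w(y, s) - (x - y)\<^sup>2 / \<epsilon> - (t - s)\<^sup>2 / \<mu> - \<delta> ((x - c)\<^sup>2 + (y - c)\<^sup>2) - \<sigma> t\<close>.
  If \<open>k (W - w)\<close> were not small, this maximum would be positive and, away from the initial time, both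
  equations could be read off there: the differences of \<open>W\<close> towards neighbouring grid points are
  controlled by those of the penalty, and the penalty is a test function for \<open>w\<close>. Up to small errors
  both equations then contain the same slope \<open>p\<close>, while the time slopes differ by \<open>\<sigma>\<close>.

  The obstacle is that \<open>e\<^sup>p\<close> is not uniformly continuous and that \<open>p\<close> could be large. Here coercivity
  helps: whichever function plays the supersolution satisfies \<open>H(p) \<le> q\<close> with a time slope \<open>q\<close> that is
  at most \<open>2 |t - s| / \<mu>\<close>, and this is bounded once \<open>\<mu>\<close> is chosen. Hence the exponentials are bounded independently of
  \<open>\<epsilon>\<close> and \<open>h\<close> (\<open>hamiltonian_gap\<close>), and so \<open>\<sigma>\<close> is chosen first, then \<open>\<mu>\<close>, then
  \<open>\<delta>\<close> and \<open>\<epsilon>\<close>, with \<open>h \<rightarrow> 0\<close> at the very end.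

  The term \<open>\<delta> (y - c)\<^sup>2\<close> with \<open>c\<close> the midpoint makes the test function violate the Neumann condition
  strictly at both ends, so that the viscosity inequality there is the equation itself. The same term
  gives the missing neighbour of an end point of the grid the favourable sign, so that its
  contribution can be added to the discrete equation.

  Near the initial time, \<open>w\<close> is controlled by its continuity, and \<open>W\<close> uniformly in \<open>h\<close> by the
  parabola \<open>A + K (x - z)\<^sup>2 + C t\<close> (\<open>discrete_barrier\<close>). The same barrier with \<open>K = 0\<close> is all that
  is needed when the interval is a single point.
\<close>

section \<open>Grids and maxima\<close>

lemma finite_grid:
  assumes "h > 0"
  shows "finite (grid a b r h)"
proof -
  have "grid a b r h \<subseteq> (\<lambda>k::int. r + of_int k * h) ` {\<lceil>(a - r) / h\<rceil>..\<lfloor>(b - r) / h\<rfloor>}"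
  proof
    fix x assume "x \<in> grid a b r h"
    then obtain k :: int where k: "x = r + of_int k * h" "a \<le> x" "x \<le> b"
      by (auto simp: grid_def)
    then have "k \<in> {\<lceil>(a - r) / h\<rceil>..\<lfloor>(b - r) / h\<rfloor>}"
      using assms by (auto simp: ceiling_le_iff le_floor_iff field_simps)
    then show "x \<in> (\<lambda>k::int. r + of_int k * h) ` {\<lceil>(a - r) / h\<rceil>..\<lfloor>(b - r) / h\<rfloor>}"
      using k by blast
  qed
  then show ?thesis
    by (rule finite_subset) simp
qed

lemma grid_right_end:
  assumes "x \<in> grid a b r h" "x + h \<notin> grid a b r h" "h > 0"
  shows "b < x + h"
proof (rule ccontr)
  assume "\<not> b < x + h"
  moreover obtain k :: int where "x = r + of_int k * h" "a \<le> x"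
    using assms by (auto simp: grid_def)
  moreover from this have "x + h = r + of_int (k + 1) * h"
    by (simp add: algebra_simps)
  ultimately have "x + h \<in> grid a b r h"
    using assms(3) unfolding grid_def by (intro CollectI conjI exI[of _ "k + 1"]) auto
  with assms show False by simp
qed

lemma grid_left_end:
  assumes "x \<in> grid a b r h" "x - h \<notin> grid a b r h" "h > 0"
  shows "x - h < a"
proof (rule ccontr)
  assume "\<not> x - h < a"
  moreover obtain k :: int where "x = r + of_int k * h" "x \<le> b"
    using assms by (auto simp: grid_def)
  moreover from this have "x - h = r + of_int (k - 1) * h"
    by (simp add: algebra_simps)
  ultimately have "x - h \<in> grid a b r h"
    using assms(3) unfolding grid_def by (intro CollectI conjI exI[of _ "k - 1"]) auto
  with assms show False by simp
qed

lemma finite_family_attains_sup: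
  fixes f :: "'a \<Rightarrow> 'b::topological_space \<Rightarrow> real"
  assumes "finite G" "G \<noteq> {}" "compact K" "K \<noteq> {}"
    and "\<And>x. x \<in> G \<Longrightarrow> continuous_on K (f x)"
  obtains x z where "x \<in> G" "z \<in> K" "\<And>x' z'. x' \<in> G \<Longrightarrow> z' \<in> K \<Longrightarrow> f x' z' \<le> f x z"
proof -
  have "\<exists>m. \<forall>x\<in>G. m x \<in> K \<and> (\<forall>z\<in>K. f x z \<le> f x (m x))"
    using continuous_attains_sup[OF assms(3,4) assms(5)] by (intro bchoice) blast
  then obtain m where m: "\<And>x. x \<in> G \<Longrightarrow> m x \<in> K" "\<And>x z. x \<in> G \<Longrightarrow> z \<in> K \<Longrightarrow> f x z \<le> f x (m x)"
    by blast
  define N where "N = Max ((\<lambda>x. f x (m x)) ` G)"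
  have "N \<in> (\<lambda>x. f x (m x)) ` G"
    unfolding N_def using assms by (intro Max_in) auto
  then obtain x where x: "x \<in> G" "N = f x (m x)" by blast
  have "f x' z' \<le> f x (m x)" if "x' \<in> G" "z' \<in> K" for x' z'
  proof -
    have "f x' z' \<le> f x' (m x')" using m that by blast
    also have "\<dots> \<le> N" unfolding N_def using assms that by (intro Max_ge) auto
    finally show ?thesis using x by simp
  qed
  with x m show ?thesis by (intro that[of x "m x"]) auto
qed

text \<open>
  At the final time of the comparison only earlier times are available; this still gives the
  inequality for the time derivative in the direction that the comparison uses.
\<close>

lemma derivative_at_left_max_nonneg:
  fixes f :: "real \<Rightarrow> real"
  assumes "(f has_real_derivative D) (at t)" "t > 0" "\<And>t'. 0 \<le> t' \<Longrightarrow> t' \<le> t \<Longrightarrow> f t' \<le> f t"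
  shows "D \<ge> 0"
proof (rule ccontr)
  assume "\<not> D \<ge> 0"
  then obtain d where d: "d > 0" "\<And>h. h > 0 \<Longrightarrow> h < d \<Longrightarrow> f t < f (t - h)"
    using DERIV_neg_dec_left[OF assms(1)] by auto
  define h where "h = min (d / 2) t"
  have "h > 0" "h < d" "h \<le> t" using d assms by (auto simp: h_def)
  with d(2)[of h] assms(3)[of "t - h"] show False by auto
qed

section \<open>A barrier for the discrete problem\<close>

text \<open>
  For \<open>k = -1\<close> the reason is \<open>2 \<le> e\<^sup>p + e\<^sup>z\<close> for \<open>-p \<le> z\<close>. The estimate lets upper and lower barriers for the
  discrete problem be treated at once.
\<close>

lemma signed_exp_le:
  fixes k p z :: real
  assumes "k = 1 \<or> k = -1" "k * p \<le> z"
  shows "k * (exp p - 1) \<le> exp z - 1"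
proof (cases "k = 1")
  case True
  with assms show ?thesis by auto
next
  case False
  then have k: "k = -1" using assms by auto
  have "1 \<le> sqrt (exp p * exp z)"
    using assms k by (simp flip: exp_add)
  also have "\<dots> \<le> (exp p + exp z) / 2"
    by (rule arith_geo_mean_sqrt) simp_all
  finally have "2 \<le> exp p + exp z" by simp
  then show ?thesis using k by simp
qed

text \<open>
  Maximum principle against a parabola that moves with speed \<open>C\<close>: as long as \<open>|x - z| \<le> D\<close>, its
  difference quotients over one step \<open>h\<close> are at most \<open>K (2 D + h)\<close>, so the right hand side of the
  discrete equation stays below \<open>C\<close> and the difference has no maximum at a positive time. A missing
  neighbour contributes \<open>0\<close>, which is also below the bound, so the ends of the grid need no separate
  treatment.
\<close>

lemma discrete_barrier:
  assumes sol: "discrete_solution G h \<Phi>p \<Phi>m w0 W"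
    and G: "finite G" and h: "h > 0" and k: "k = 1 \<or> k = -1"
    and \<Phi>: "\<And>x. x \<in> G \<Longrightarrow> 0 \<le> \<Phi>p x \<and> \<Phi>p x \<le> M \<and> 0 \<le> \<Phi>m x \<and> \<Phi>m x \<le> M"
    and D: "\<And>x. x \<in> G \<Longrightarrow> \<bar>x - z\<bar> \<le> D" and K: "K \<ge> 0"
    and init: "\<And>x. x \<in> G \<Longrightarrow> k * w0 x \<le> A + K * (x - z)\<^sup>2"
    and C: "C > 2 * M * (exp (K * (2 * D + h)) - 1)"
    and x: "x \<in> G" and t: "t \<ge> 0"
  shows "k * W x t \<le> A + K * (x - z)\<^sup>2 + C * t"
proof -
  define f where "f = (\<lambda>x s. k * W x s - K * (x - z)\<^sup>2 - C * s)"
  have "continuous_on {0..t} (f x)" if "x \<in> G" for x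
    using sol that unfolding f_def discrete_solution_def
    by (intro continuous_intros) (auto intro: continuous_on_subset)
  then obtain x1 t1 where m: "x1 \<in> G" "t1 \<in> {0..t}"
    "\<And>x' t'. x' \<in> G \<Longrightarrow> t' \<in> {0..t} \<Longrightarrow> f x' t' \<le> f x1 t1"
    using finite_family_attains_sup[of G "{0..t}" f] G x t by auto
  have "t1 = 0"
  proof (rule ccontr)
    assume "t1 \<noteq> 0"
    then have t1: "t1 > 0" using m by simp
    define E where "E = exp (K * (2 * D + h)) - 1"
    define d where "d = indicator G (x1 + h) * \<Phi>p x1 * (exp ((W (x1 + h) t1 - W x1 t1) / h) - 1) +
           indicator G (x1 - h) * \<Phi>m x1 * (exp ((W (x1 - h) t1 - W x1 t1) / h) - 1)"
    have "(W x1 has_real_derivative d) (at t1)"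
      using sol m(1) t1 unfolding discrete_solution_def d_def by blast
    then have "(f x1 has_real_derivative k * d - C) (at t1)"
      unfolding f_def by (auto intro!: derivative_eq_intros)
    then have "k * d - C \<ge> 0"
      using t1 m by (intro derivative_at_left_max_nonneg[of "f x1" _ t1]) auto
    moreover have "D \<ge> 0" using D[OF x] by linarith
    then have E: "E \<ge> 0" unfolding E_def using K h by simp
    have step: "indicator G (x1 + e) * P * (k * (exp ((W (x1 + e) t1 - W x1 t1) / h) - 1)) \<le> M * E"
      if e: "e = h \<or> e = -h" and P: "0 \<le> P" "P \<le> M" for e P
    proof (cases "x1 + e \<in> G")
      case True
      have "k * (W (x1 + e) t1 - W x1 t1) \<le> K * ((x1 + e - z)\<^sup>2 - (x1 - z)\<^sup>2)"
        using m(3)[OF True m(2)] by (simp add: f_def algebra_simps)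
      also have "\<dots> \<le> K * (h * (2 * D + h))"
      proof (intro mult_left_mono K)
        have "(x1 + e - z)\<^sup>2 - (x1 - z)\<^sup>2 = e * (2 * (x1 - z) + e)"
          by (simp add: power2_eq_square algebra_simps)
        also have "\<dots> \<le> \<bar>e\<bar> * \<bar>2 * (x1 - z) + e\<bar>"
          by (metis abs_ge_self abs_mult)
        also have "\<dots> \<le> \<bar>e\<bar> * (2 * \<bar>x1 - z\<bar> + \<bar>e\<bar>)"
          using abs_triangle_ineq[of "2 * (x1 - z)" e]
          by (intro mult_left_mono) (simp_all only: abs_mult abs_numeral abs_ge_zero)
        also have "\<dots> \<le> h * (2 * D + h)" using e h D[OF m(1)] by auto
        finally show "(x1 + e - z)\<^sup>2 - (x1 - z)\<^sup>2 \<le> h * (2 * D + h)" .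
      qed
      finally have "k * ((W (x1 + e) t1 - W x1 t1) / h) \<le> K * (2 * D + h)"
        using pos_divide_le_eq[OF h, of "k * (W (x1 + e) t1 - W x1 t1)" "K * (2 * D + h)"]
        by (simp add: mult.commute mult.left_commute)
      then have "k * (exp ((W (x1 + e) t1 - W x1 t1) / h) - 1) \<le> E"
        unfolding E_def by (rule signed_exp_le[OF k])
      then have "P * (k * (exp ((W (x1 + e) t1 - W x1 t1) / h) - 1)) \<le> P * E"
        using P by (intro mult_left_mono) auto
      also have "\<dots> \<le> M * E" using P E by (intro mult_right_mono) auto
      finally show ?thesis using True by simp
    next
      case False
      with P E show ?thesis by simp
    qed
    have "k * d \<le> M * E + M * E"
      using step[of h "\<Phi>p x1"] step[of "-h" "\<Phi>m x1"] \<Phi>[OF m(1)]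
      unfolding d_def by (simp add: algebra_simps)
    ultimately show False using C unfolding E_def by simp
  qed
  then have "f x t \<le> f x1 0" using m(3)[OF x, of t] t by simp
  also have "\<dots> \<le> A"
    using init[OF m(1)] sol m(1) by (simp add: f_def discrete_solution_def)
  finally show ?thesis by (simp add: f_def algebra_simps)
qed

section \<open>Coercivity of the Hamiltonian\<close>

text \<open>
  Index \<open>2\<close> belongs to the supersolution, index \<open>1\<close> to the subsolution. The supersolution inequality
  with \<open>q \<le> Q\<close> bounds both \<open>e\<^bsup>p2\<^esup>\<close> and \<open>e\<^bsup>m2\<^esup>\<close> by \<open>(Q + 2 M) / c0\<close>, and then changing coefficients
  and slopes by at most \<open>\<rho>\<close> raises the Hamiltonian by less than \<open>\<sigma>\<close>. Since the exponential is
  increasing, one-sided bounds on the slopes suffice. The slopes \<open>p\<close> and \<open>m\<close> are kept separate because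
  the forward and backward slopes of a discrete function are not opposite to each other.
\<close>

lemma hamiltonian_gap:
  fixes c0 M Q \<sigma> :: real
  assumes "c0 > 0" "\<sigma> > 0" "M > 0" "Q \<ge> 0"
  obtains \<rho> where "\<rho> > 0"
    "\<And>A1 B1 A2 B2 p1 m1 p2 m2 q. \<lbrakk>c0 \<le> A2; A2 \<le> M; c0 \<le> B2; B2 \<le> M; 0 \<le> A1; A1 \<le> M; 0 \<le> B1; B1 \<le> M;
       \<bar>A1 - A2\<bar> \<le> \<rho>; \<bar>B1 - B2\<bar> \<le> \<rho>; p1 \<le> p2 + \<rho>; m1 \<le> m2 + \<rho>; q \<le> Q;
       A2 * (exp p2 - 1) + B2 * (exp m2 - 1) \<le> q\<rbrakk>
       \<Longrightarrow> A1 * (exp p1 - 1) + B1 * (exp m1 - 1) < q + \<sigma>"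
proof -
  define E where "E = (Q + 2 * M) / c0"
  have E: "E > 0" using assms by (simp add: E_def add_nonneg_pos)
  define g where "g = (\<lambda>\<rho>. 2 * (\<rho> * (E + 1) + M * E * (exp \<rho> - 1)))"
  have "(g \<longlongrightarrow> g 0) (at_right 0)"
    unfolding g_def by (intro tendsto_intros)
  then have "\<forall>\<^sub>F \<rho> in at_right 0. g \<rho> < \<sigma>"
    using assms by (intro order_tendstoD) (auto simp: g_def)
  moreover have "\<forall>\<^sub>F \<rho>::real in at_right 0. \<rho> > 0"
    by (simp add: eventually_at_right_less)
  ultimately have "\<forall>\<^sub>F \<rho> in at_right 0. g \<rho> < \<sigma> \<and> \<rho> > 0"
    by (rule eventually_conj)
  then obtain \<rho> where \<rho>: "g \<rho> < \<sigma>" "\<rho> > 0"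
    using eventually_happens'[OF trivial_limit_at_right_real] by blast
  \<comment> \<open>one of the two exponential terms, given a bound \<open>E\<close> for the exponential of the supersolution\<close>
  have half: "A1 * (exp p1 - 1) - A2 * (exp p2 - 1) \<le> \<rho> * (E + 1) + M * E * (exp \<rho> - 1)"
    if "0 \<le> A1" "A1 \<le> M" "\<bar>A1 - A2\<bar> \<le> \<rho>" "p1 \<le> p2 + \<rho>" "exp p2 \<le> E" for A1 A2 p1 p2
  proof -
    have "A1 * (exp p1 - 1) - A2 * (exp p2 - 1) = (A1 - A2) * (exp p2 - 1) + A1 * (exp p1 - exp p2)"
      by (simp add: algebra_simps)
    also have "(A1 - A2) * (exp p2 - 1) \<le> \<bar>A1 - A2\<bar> * \<bar>exp p2 - 1\<bar>"
      by (metis abs_ge_self abs_mult)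
    also have "\<dots> \<le> \<rho> * (E + 1)"
      using that \<rho> E by (intro mult_mono) (auto simp: abs_le_iff intro: add_nonneg_nonneg order_trans[of _ 0])
    also have "A1 * (exp p1 - exp p2) \<le> A1 * (E * (exp \<rho> - 1))"
    proof (intro mult_left_mono)
      have "exp p1 - exp p2 \<le> exp (p2 + \<rho>) - exp p2" using that by simp
      also have "\<dots> = exp p2 * (exp \<rho> - 1)" by (simp add: exp_add algebra_simps)
      also have "\<dots> \<le> E * (exp \<rho> - 1)" using that \<rho> by (intro mult_right_mono) auto
      finally show "exp p1 - exp p2 \<le> E * (exp \<rho> - 1)" .
    qed (use that in auto)
    also have "A1 * (E * (exp \<rho> - 1)) \<le> M * (E * (exp \<rho> - 1))"
      using that E \<rho> by (intro mult_right_mono) auto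
    finally show ?thesis by (simp add: algebra_simps)
  qed
  have bnd: "exp p2 \<le> E" if "c0 \<le> A2" "A2 \<le> M" "c0 \<le> B2" "B2 \<le> M" "q \<le> Q"
      "A2 * (exp p2 - 1) + B2 * (exp m2 - 1) \<le> q" for A2 B2 p2 m2 q
  proof -
    have "c0 * exp p2 \<le> A2 * exp p2" using that by simp
    also have "\<dots> \<le> Q + A2 + B2 - B2 * exp m2" using that by (simp add: algebra_simps)
    also have "\<dots> \<le> Q + 2 * M"
    proof -
      have "B2 * exp m2 \<ge> 0" using that assms by simp
      then show ?thesis using that by linarith
    qed
    finally show ?thesis using assms by (simp add: E_def field_simps)
  qed
  show ?thesis
  proof (rule that[OF \<rho>(2)])
    fix A1 B1 A2 B2 p1 m1 p2 m2 q :: real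
    assume *: "c0 \<le> A2" "A2 \<le> M" "c0 \<le> B2" "B2 \<le> M" "0 \<le> A1" "A1 \<le> M" "0 \<le> B1" "B1 \<le> M"
       "\<bar>A1 - A2\<bar> \<le> \<rho>" "\<bar>B1 - B2\<bar> \<le> \<rho>" "p1 \<le> p2 + \<rho>" "m1 \<le> m2 + \<rho>" "q \<le> Q"
       "A2 * (exp p2 - 1) + B2 * (exp m2 - 1) \<le> q"
    have "exp p2 \<le> E" "exp m2 \<le> E"
      using bnd[of A2 B2 q p2 m2] bnd[of B2 A2 q m2 p2] * by (auto simp: add.commute)
    then show "A1 * (exp p1 - 1) + B1 * (exp m1 - 1) < q + \<sigma>"
      using half[of A1 A2 p1 p2] half[of B1 B2 m1 m2] * \<rho>(1) unfolding g_def by (smt (verit))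
  qed
qed

section \<open>Touching by the doubling penalty\<close>

definition penalty :: "real \<Rightarrow> real \<Rightarrow> real \<Rightarrow> real \<Rightarrow> real \<Rightarrow> real \<Rightarrow> real \<Rightarrow> real \<Rightarrow> real \<Rightarrow> real"
  where "penalty c \<epsilon> \<mu> \<delta> \<sigma> x t y s =
    (x - y)\<^sup>2 / \<epsilon> + (t - s)\<^sup>2 / \<mu> + \<delta> * ((x - c)\<^sup>2 + (y - c)\<^sup>2) + \<sigma> * t"

lemma C1_partials_penalty:
  "C1_partials (\<lambda>z. k * penalty c \<epsilon> \<mu> \<delta> \<sigma> x t (fst z) (snd z))
     (\<lambda>z. k * (- 2 * (x - fst z) / \<epsilon> + 2 * \<delta> * (fst z - c)))
     (\<lambda>z. k * (- 2 * (t - snd z) / \<mu>))"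
  unfolding C1_partials_def penalty_def
proof (intro conjI allI)
  fix z :: "real \<times> real"
  show "((\<lambda>z. k * ((x - fst z)\<^sup>2 / \<epsilon> + (t - snd z)\<^sup>2 / \<mu> + \<delta> * ((x - c)\<^sup>2 + (fst z - c)\<^sup>2) + \<sigma> * t))
    has_derivative (\<lambda>v. k * (- 2 * (x - fst z) / \<epsilon> + 2 * \<delta> * (fst z - c)) * fst v
      + k * (- 2 * (t - snd z) / \<mu>) * snd v)) (at z)"
    (is "(?f has_derivative ?d) _")
  proof -
    define e l where "e = 1 / \<epsilon>" "l = 1 / \<mu>"
    have "?f = (\<lambda>z. k * (e * (x - fst z)\<^sup>2 + l * (t - snd z)\<^sup>2 + \<delta> * ((x - c)\<^sup>2 + (fst z - c)\<^sup>2) + \<sigma> * t))"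
      by (simp add: e_l_def)
    moreover have "?d = (\<lambda>v. k * (e * (2 * (x - fst z) * - fst v) + l * (2 * (t - snd z) * - snd v)
        + \<delta> * (2 * (fst z - c) * fst v)))"
      by (simp add: e_l_def fun_eq_iff diff_divide_distrib algebra_simps)
    ultimately show ?thesis
      by (auto intro!: derivative_eq_intros simp: fun_eq_iff algebra_simps)
  qed
next
  show "continuous_on UNIV (\<lambda>z. k * (- 2 * (x - fst z) / \<epsilon> + 2 * \<delta> * (fst z - c)))"
    unfolding divide_inverse by (intro continuous_intros)
  show "continuous_on UNIV (\<lambda>z. k * (- 2 * (t - snd z) / \<mu>))"
    unfolding divide_inverse by (intro continuous_intros)
qed

text \<open>
  The maximum is taken over times up to \<open>T'\<close>, whereas a viscosity solution is tested on all later
  times; an extremum before \<open>T'\<close> is a local one.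
\<close>

lemma eventually_before_time:
  fixes y s a b T' :: real
  assumes "s < T'"
  shows "\<forall>\<^sub>F z in at (y, s) within {a..b} \<times> {0..}. z \<in> {a..b} \<times> {0..T'}"
proof -
  have "open ((UNIV::real set) \<times> {..<T'::real})" by (intro open_Times) auto
  then have "\<forall>\<^sub>F z in at (y, s) within {a..b} \<times> {0..}. z \<in> {a..b} \<times> {0..} \<and> z \<in> UNIV \<times> {..<T'}"
    using assms unfolding eventually_at_topological by (intro exI[of _ "UNIV \<times> {..<T'}"]) auto
  then show ?thesis by (rule eventually_mono) auto
qed

text \<open>
  The sign conditions \<open>bd\<close> rule out the Neumann alternative at the end points, so that the equation
  itself holds wherever the penalty touches.
\<close>

lemma supersolution_at_touching:
  assumes sol: "viscosity_supersolution a b H w0 w"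
    and y: "y \<in> {a..b}" and s: "0 < s" "s < T'"
    and min: "\<And>y' s'. y' \<in> {a..b} \<Longrightarrow> s' \<in> {0..T'} \<Longrightarrow>
      w (y, s) + penalty c \<epsilon> \<mu> \<delta> \<sigma> x t y s \<le> w (y', s') + penalty c \<epsilon> \<mu> \<delta> \<sigma> x t y' s'"
    and p: "p = 2 * (x - y) / \<epsilon> - 2 * \<delta> * (y - c)"
    and bd: "y = a \<Longrightarrow> p > 0" "y = b \<Longrightarrow> p < 0"
  shows "H y p \<le> 2 * (t - s) / \<mu>"
proof -
  let ?\<phi> = "\<lambda>z. (-1) * penalty c \<epsilon> \<mu> \<delta> \<sigma> x t (fst z) (snd z)"
  have touch: "local_min_on ({a..b} \<times> {0..}) (\<lambda>z. w z - ?\<phi> z) (y, s)"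
    unfolding local_min_on_def
    by (rule eventually_mono[OF eventually_before_time[OF s(2)]]) (use min in auto)
  have slope: "- 1 * (- 2 * (x - y) / \<epsilon> + 2 * \<delta> * (y - c)) = p" "- 1 * (- 2 * (t - s) / \<mu>) = 2 * (t - s) / \<mu>"
    unfolding p by (simp_all add: diff_divide_distrib algebra_simps)
  note conjunct2[OF conjunct2[OF sol[unfolded viscosity_supersolution_def]], THEN spec, THEN spec, THEN spec,
    THEN spec, THEN spec, THEN mp, THEN mp, THEN mp, THEN mp, OF C1_partials_penalty y s(1) touch]
  then have "(y \<in> {a<..<b} \<longrightarrow> 2 * (t - s) / \<mu> - H y p \<ge> 0) \<and>
        (y = a \<longrightarrow> max (2 * (t - s) / \<mu> - H y p) (- p) \<ge> 0) \<and>
        (y = b \<longrightarrow> max (2 * (t - s) / \<mu> - H y p) p \<ge> 0)"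
    using slope by (cases "y = a"; cases "y = b") (simp_all only: fst_conv snd_conv simp_thms)
  then show ?thesis
    using bd y by (cases "y = a"; cases "y = b") (auto simp: max_def split: if_splits)
qed

lemma subsolution_at_touching:
  assumes sol: "viscosity_subsolution a b H w0 w"
    and y: "y \<in> {a..b}" and s: "0 < s" "s < T'"
    and max: "\<And>y' s'. y' \<in> {a..b} \<Longrightarrow> s' \<in> {0..T'} \<Longrightarrow>
      w (y', s') - penalty c \<epsilon> \<mu> \<delta> \<sigma> x t y' s' \<le> w (y, s) - penalty c \<epsilon> \<mu> \<delta> \<sigma> x t y s"
    and p: "p = 2 * (x - y) / \<epsilon> - 2 * \<delta> * (y - c)"
    and bd: "y = a \<Longrightarrow> p > 0" "y = b \<Longrightarrow> p < 0"
  shows "- (2 * (t - s) / \<mu>) \<le> H y (- p)"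
proof -
  let ?\<phi> = "\<lambda>z. 1 * penalty c \<epsilon> \<mu> \<delta> \<sigma> x t (fst z) (snd z)"
  have touch: "local_max_on ({a..b} \<times> {0..}) (\<lambda>z. w z - ?\<phi> z) (y, s)"
    unfolding local_max_on_def
    by (rule eventually_mono[OF eventually_before_time[OF s(2)]]) (use max in auto)
  have slope: "1 * (- 2 * (x - y) / \<epsilon> + 2 * \<delta> * (y - c)) = - p" "1 * (- 2 * (t - s) / \<mu>) = - (2 * (t - s) / \<mu>)"
    unfolding p by (simp_all add: diff_divide_distrib algebra_simps)
  note conjunct2[OF conjunct2[OF sol[unfolded viscosity_subsolution_def]], THEN spec, THEN spec, THEN spec,
    THEN spec, THEN spec, THEN mp, THEN mp, THEN mp, THEN mp, OF C1_partials_penalty y s(1) touch]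
  then have "(y \<in> {a<..<b} \<longrightarrow> - (2 * (t - s) / \<mu>) - H y (- p) \<le> 0) \<and>
        (y = a \<longrightarrow> min (- (2 * (t - s) / \<mu>) - H y (- p)) (- (- p)) \<le> 0) \<and>
        (y = b \<longrightarrow> min (- (2 * (t - s) / \<mu>) - H y (- p)) (- p) \<le> 0)"
    using slope by (cases "y = a"; cases "y = b") (simp_all only: fst_conv snd_conv simp_thms)
  then show ?thesis
    using bd y by (cases "y = a"; cases "y = b") (auto simp: min_def split: if_splits)
qed

lemma time_slope_at_left_max:
  assumes W: "(W has_real_derivative d) (at t)" and t: "0 < t"
    and max: "\<And>t'. t' \<in> {0..t} \<Longrightarrow>
      k * W t' - penalty c \<epsilon> \<mu> \<delta> \<sigma> x t' y s \<le> k * W t - penalty c \<epsilon> \<mu> \<delta> \<sigma> x t y s"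
  shows "2 * (t - s) / \<mu> + \<sigma> \<le> k * d"
proof -
  have "((\<lambda>t. k * W t - penalty c \<epsilon> \<mu> \<delta> \<sigma> x t y s) has_real_derivative
      k * d - (2 * (t - s) / \<mu> + \<sigma>)) (at t)"
  proof -
    define e l where "e = (x - y)\<^sup>2 / \<epsilon> + \<delta> * ((x - c)\<^sup>2 + (y - c)\<^sup>2)" "l = 1 / \<mu>"
    have "penalty c \<epsilon> \<mu> \<delta> \<sigma> x t y s = e + l * (t - s)\<^sup>2 + \<sigma> * t" for t
      by (simp add: penalty_def e_l_def)
    moreover have "2 * (t - s) / \<mu> = l * (2 * (t - s))"
      by (simp add: e_l_def)
    ultimately show ?thesis
      by (auto intro!: derivative_eq_intros W)
  qed
  from derivative_at_left_max_nonneg[OF this t] max show ?thesis by simp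
qed

text \<open>
  The number \<open>\<pi> e\<close> is the slope that the penalty allows towards the neighbour \<open>x + e\<close>. If that
  neighbour is missing, then \<open>0 \<le> \<pi> e\<close> makes the term that the full Hamiltonian has in addition
  nonnegative (here) or nonpositive (in the next lemma).
\<close>

lemma discrete_rhs_le:
  assumes h: "h > 0" and A: "0 \<le> A" "0 \<le> B"
    and nb: "\<And>e. e = h \<or> e = -h \<Longrightarrow> x + e \<in> G \<Longrightarrow>
      (W (x + e) - W x) / h \<le> \<pi> e"
    and out: "\<And>e. e = h \<or> e = -h \<Longrightarrow> x + e \<notin> G \<Longrightarrow> 0 \<le> \<pi> e"
  shows "indicator G (x + h) * A * (exp ((W (x + h) - W x) / h) - 1) +
    indicator G (x - h) * B * (exp ((W (x - h) - W x) / h) - 1)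
    \<le> A * (exp (\<pi> h) - 1) + B * (exp (\<pi> (- h)) - (1::real))"
proof -
  have "indicator G (x + e) * P * (exp ((W (x + e) - W x) / h) - 1) \<le> P * (exp (\<pi> e) - 1)"
    if "e = h \<or> e = -h" "0 \<le> P" for e P
    using nb[OF that(1)] out[OF that(1)] that(2) by (cases "x + e \<in> G") (auto intro: mult_left_mono)
  from add_mono[OF this[of h A] this[of "-h" B]] A show ?thesis by simp
qed

lemma discrete_rhs_ge:
  assumes h: "h > 0" and A: "0 \<le> A" "0 \<le> B"
    and nb: "\<And>e. e = h \<or> e = -h \<Longrightarrow> x + e \<in> G \<Longrightarrow>
      - \<pi> e \<le> (W (x + e) - W x) / h"
    and out: "\<And>e. e = h \<or> e = -h \<Longrightarrow> x + e \<notin> G \<Longrightarrow> 0 \<le> \<pi> e"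
  shows "A * (exp (- \<pi> h) - 1) + B * (exp (- \<pi> (- h)) - (1::real))
    \<le> indicator G (x + h) * A * (exp ((W (x + h) - W x) / h) - 1) +
    indicator G (x - h) * B * (exp ((W (x - h) - W x) / h) - 1)"
proof -
  have "P * (exp (- \<pi> e) - 1) \<le> indicator G (x + e) * P * (exp ((W (x + e) - W x) / h) - 1)"
    if "e = h \<or> e = -h" "0 \<le> P" for e P
    using nb[OF that(1)] out[OF that(1)] that(2)
    by (cases "x + e \<in> G") (auto intro: mult_left_mono simp: mult_nonneg_nonpos)
  from add_mono[OF this[of h A] this[of "-h" B]] A show ?thesis by simp
qed

section \<open>The doubling argument\<close>

text \<open>
  All parameters are fixed here, and the hypotheses list exactly how small each has to be relative to
  the earlier ones. The sign \<open>k\<close> decides whether \<open>W\<close> is compared from above, and \<open>w\<close> acts as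
  supersolution, or from below, and \<open>w\<close> acts as subsolution; in both cases the strictness \<open>\<sigma>\<close> sits on
  the discrete equation. The time variable of \<open>w\<close> ranges over one more unit than that of \<open>W\<close>, so that
  the maximum point is never at the last time for \<open>w\<close>.
\<close>

lemma doubling_estimate:
  fixes a b :: real and w :: "real \<times> real \<Rightarrow> real"
  defines "c \<equiv> (a + b) / 2"
  assumes ab: "a < b" and h: "0 < h" "h \<le> 1" and T: "0 \<le> T" and k: "k = 1 \<or> k = -1"
    and sol: "viscosity_solution a b (hamiltonian \<Phi>p \<Phi>m) w0 w"
    and G: "G = grid al bl r h" and ends: "\<bar>al - a\<bar> \<le> h" "\<bar>bl - b\<bar> \<le> h"
    and dsol: "discrete_solution G h \<Psi>p \<Psi>m v0 W"
    and \<Phi>: "\<And>y. y \<in> {a..b} \<Longrightarrow> c0 \<le> \<Phi>p y \<and> \<Phi>p y \<le> M \<and> c0 \<le> \<Phi>m y \<and> \<Phi>m y \<le> M"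
    and \<Psi>: "\<And>x. x \<in> G \<Longrightarrow> c0 \<le> \<Psi>p x \<and> \<Psi>p x \<le> M \<and> c0 \<le> \<Psi>m x \<and> \<Psi>m x \<le> M"
    and c0: "0 \<le> c0"
    and K0: "\<And>y s. y \<in> {a..b} \<Longrightarrow> s \<in> {0..T + 1} \<Longrightarrow> \<bar>w (y, s)\<bar> \<le> K0"
    and pos: "0 < \<epsilon>" "0 < \<mu>" "0 < \<delta>" "0 < \<sigma>" "0 < \<tau>" "\<tau> < 1" "0 < d"
    and \<mu>: "(2 * K0 + 1) * \<mu> \<le> \<tau>\<^sup>2" and \<epsilon>: "(2 * K0 + 1) * \<epsilon> \<le> d\<^sup>2"
    and small: "h\<^sup>2 / \<epsilon> + \<delta> * (b - a + 1)\<^sup>2 \<le> 1"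
      "h\<^sup>2 / \<epsilon> + 2 * \<delta> * (b - a + 1)\<^sup>2 + \<sigma> * T \<le> \<eta> / 4"
      "h / \<epsilon> + \<delta> * (2 * (b - a) + 3) \<le> \<rho>" "3 * h / \<epsilon> + 3 * \<delta> * h < \<delta> * (b - a)"
    and layer: "\<And>x y t. x \<in> G \<Longrightarrow> y \<in> {a..b} \<Longrightarrow> \<bar>x - y\<bar> \<le> d \<Longrightarrow> 0 \<le> t \<Longrightarrow> t \<le> \<tau> \<Longrightarrow>
      k * W x t \<le> k * w0 y + \<eta> / 4"
    and wlayer: "\<And>y s. y \<in> {a..b} \<Longrightarrow> 0 \<le> s \<Longrightarrow> s \<le> \<tau> \<Longrightarrow> \<bar>w (y, s) - w0 y\<bar> \<le> \<eta> / 4"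
    and near: "\<And>x y. x \<in> G \<Longrightarrow> y \<in> {a..b} \<Longrightarrow> \<bar>x - y\<bar> \<le> d \<Longrightarrow>
      \<bar>\<Psi>p x - \<Phi>p y\<bar> \<le> \<rho> \<and> \<bar>\<Psi>m x - \<Phi>m y\<bar> \<le> \<rho>"
    and gap: "\<And>A1 B1 A2 B2 p1 m1 p2 m2 q. \<lbrakk>c0 \<le> A2; A2 \<le> M; c0 \<le> B2; B2 \<le> M; 0 \<le> A1; A1 \<le> M; 0 \<le> B1; B1 \<le> M;
       \<bar>A1 - A2\<bar> \<le> \<rho>; \<bar>B1 - B2\<bar> \<le> \<rho>; p1 \<le> p2 + \<rho>; m1 \<le> m2 + \<rho>; q \<le> 2 * \<tau> / \<mu>;
       A2 * (exp p2 - 1) + B2 * (exp m2 - 1) \<le> q\<rbrakk>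
       \<Longrightarrow> A1 * (exp p1 - 1) + B1 * (exp m1 - 1) < q + \<sigma>"
    and x: "x' \<in> G" and t: "t' \<in> {0..T}" and y: "y' \<in> {a..b}" "\<bar>x' - y'\<bar> \<le> h"
  shows "k * (W x' t' - w (y', t')) \<le> \<eta>"
proof (rule ccontr)
  assume contra: "\<not> k * (W x' t' - w (y', t')) \<le> \<eta>"
  let ?P = "penalty c \<epsilon> \<mu> \<delta> \<sigma>"
  define f where "f = (\<lambda>x (t, y, s). k * W x t - k * w (y, s) - ?P x t y s)"
  define Z where "Z = {0..T} \<times> {a..b} \<times> {0..T + 1}"
  have Gab: "a - h \<le> x \<and> x \<le> b + h" if "x \<in> G" for x
    using that ends by (auto simp: G grid_def)
  have finG: "finite G" unfolding G by (rule finite_grid[OF h(1)])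
  have "continuous_on Z (f x)" if "x \<in> G" for x
  proof -
    have "continuous_on {0..} (W x)" using dsol that by (simp add: discrete_solution_def)
    then have "continuous_on Z (\<lambda>z. W x (fst z))"
      by (rule continuous_on_compose2) (auto simp: Z_def intro!: continuous_intros)
    moreover have "continuous_on ({a..b} \<times> {0..}) w" using sol by (simp add: viscosity_solution_def)
    then have "continuous_on Z (\<lambda>z. w (fst (snd z), snd (snd z)))"
      by (rule continuous_on_compose2) (auto simp: Z_def intro!: continuous_intros)
    ultimately show ?thesis
      using pos unfolding f_def penalty_def case_prod_unfold by (intro continuous_intros) auto
  qed
  moreover have "compact Z" "Z \<noteq> {}" "G \<noteq> {}"
    using ab T x by (auto simp: Z_def intro!: compact_Times)
  ultimately obtain x z where xz: "x \<in> G" "z \<in> Z"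
    and maxz: "\<And>x' z'. x' \<in> G \<Longrightarrow> z' \<in> Z \<Longrightarrow> f x' z' \<le> f x z"
    using finite_family_attains_sup[OF finG, of Z f] by blast
  obtain t y s where z: "z = (t, y, s)" by (cases z)
  have tys: "t \<in> {0..T}" "y \<in> {a..b}" "s \<in> {0..T + 1}" using xz z by (auto simp: Z_def)
  have max: "k * W x1 t1 - k * w (y1, s1) - ?P x1 t1 y1 s1 \<le> k * W x t - k * w (y, s) - ?P x t y s"
    if "x1 \<in> G" "t1 \<in> {0..T}" "y1 \<in> {a..b}" "s1 \<in> {0..T + 1}" for x1 t1 y1 s1
    using maxz[of x1 "(t1, y1, s1)"] that by (simp add: Z_def z f_def)
  have sq: "(u - c)\<^sup>2 \<le> (b - a + 1)\<^sup>2" if "a - h \<le> u" "u \<le> b + h" for u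
    using that h ab by (intro abs_le_square_iff[THEN iffD1]) (auto simp: c_def abs_le_iff field_simps)

  \<comment> \<open>moving \<open>w\<close> to the point of \<open>[a, b]\<close> nearest to \<open>x\<close>, at time \<open>t\<close>, can only lower the value\<close>
  have dist: "(x - y)\<^sup>2 / \<epsilon> + (t - s)\<^sup>2 / \<mu> \<le> 2 * K0 + 1"
  proof -
    define u where "u = max a (min b x)"
    have u: "u \<in> {a..b}" "\<bar>x - u\<bar> \<le> \<bar>h\<bar>" using Gab[OF xz(1)] ab h by (auto simp: u_def)
    have "- k * w (y, s) - ((x - y)\<^sup>2 / \<epsilon> + (t - s)\<^sup>2 / \<mu>) - \<delta> * (y - c)\<^sup>2
      \<ge> - k * w (u, t) - (x - u)\<^sup>2 / \<epsilon> - \<delta> * (u - c)\<^sup>2"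
      using max[OF xz(1) tys(1) u(1), of t] tys(1) by (simp add: penalty_def algebra_simps)
    moreover have "(x - u)\<^sup>2 / \<epsilon> \<le> h\<^sup>2 / \<epsilon>"
      using u(2) pos by (intro divide_right_mono) (auto simp: abs_le_square_iff)
    moreover have "\<delta> * (u - c)\<^sup>2 \<le> \<delta> * (b - a + 1)\<^sup>2"
      using u(1) h pos by (intro mult_left_mono sq) auto
    moreover have "\<delta> * (y - c)\<^sup>2 \<ge> 0" using pos by simp
    moreover have "\<bar>w (u, t)\<bar> \<le> K0" "\<bar>w (y, s)\<bar> \<le> K0"
      using K0 u(1) tys by auto
    then have "k * w (u, t) - k * w (y, s) \<le> 2 * K0" using k by auto
    ultimately show ?thesis using small(1) by simp
  qed
  have "0 \<le> (x - y)\<^sup>2 / \<epsilon>" "0 \<le> (t - s)\<^sup>2 / \<mu>"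
    using pos by simp_all
  then have "(x - y)\<^sup>2 / \<epsilon> \<le> 2 * K0 + 1" "(t - s)\<^sup>2 / \<mu> \<le> 2 * K0 + 1"
    using dist by linarith+
  then have "(x - y)\<^sup>2 \<le> d\<^sup>2" "(t - s)\<^sup>2 \<le> \<tau>\<^sup>2"
    using \<mu> \<epsilon> pos by (simp_all add: pos_divide_le_eq)
  then have xy: "\<bar>x - y\<bar> \<le> d" and ts: "\<bar>t - s\<bar> \<le> \<tau>"
    using pos by (simp_all flip: abs_le_square_iff)

  \<comment> \<open>the assumed gap at \<open>(x', t', y')\<close> survives at the maximum point, hence that is not at time 0\<close>
  have "\<eta> - \<eta> / 4 < k * W x t - k * w (y, s)"
  proof -
    have "(x' - y')\<^sup>2 / \<epsilon> \<le> h\<^sup>2 / \<epsilon>"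
      using y(2) pos h by (intro divide_right_mono) (auto simp flip: abs_le_square_iff)
    moreover have "\<delta> * ((x' - c)\<^sup>2 + (y' - c)\<^sup>2) \<le> 2 * \<delta> * (b - a + 1)\<^sup>2"
    proof -
      have "(x' - c)\<^sup>2 + (y' - c)\<^sup>2 \<le> 2 * (b - a + 1)\<^sup>2"
        using sq[of x'] sq[of y'] Gab[OF x] y h by auto
      from mult_left_mono[OF this, of \<delta>] show ?thesis using pos by simp
    qed
    moreover have "\<sigma> * t' \<le> \<sigma> * T" using t pos by simp
    moreover have "?P x' t' y' t' = (x' - y')\<^sup>2 / \<epsilon> + \<delta> * ((x' - c)\<^sup>2 + (y' - c)\<^sup>2) + \<sigma> * t'"
      by (simp add: penalty_def)
    ultimately have "?P x' t' y' t' \<le> \<eta> / 4" using small(2) by linarith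
    moreover have "?P x t y s \<ge> 0" using pos tys by (simp add: penalty_def)
    ultimately show ?thesis
      using max[OF x t y(1), of t'] t contra by (simp add: algebra_simps)
  qed
  moreover have "k * W x t - k * w (y, s) \<le> \<eta> / 4 + \<eta> / 4" if "t = 0 \<or> s = 0"
  proof -
    have "k * W x t \<le> k * w0 y + \<eta> / 4" using layer[OF xz(1) tys(2) xy, of t] that ts tys by auto
    moreover have "\<bar>w (y, s) - w0 y\<bar> \<le> \<eta> / 4" using wlayer[OF tys(2), of s] that ts tys by auto
    moreover have "k * w0 y - k * w (y, s) \<le> \<bar>w (y, s) - w0 y\<bar>" using k by auto
    ultimately show ?thesis by linarith
  qed
  moreover have "\<eta> > 0"
  proof -
    have "0 \<le> h\<^sup>2 / \<epsilon>" "0 < 2 * \<delta> * (b - a + 1)\<^sup>2" "0 \<le> \<sigma> * T"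
      using pos ab T by simp_all
    then show ?thesis using small(2) by linarith
  qed
  ultimately have t0: "0 < t" and s0: "0 < s" using tys by (force simp: less_le)+
  have sT: "s < T + 1" using ts tys pos by auto

  \<comment> \<open>\<open>p\<close> is the slope seen by \<open>w\<close>, \<open>\<pi> h\<close> and \<open>\<pi> (- h)\<close> are those seen by \<open>W\<close>; signs refer to \<open>k = 1\<close>\<close>
  define p where "p = 2 * (x - y) / \<epsilon> - 2 * \<delta> * (y - c)"
  define \<pi> where "\<pi> = (\<lambda>e. (((x + e - y)\<^sup>2 - (x - y)\<^sup>2) / \<epsilon> + \<delta> * ((x + e - c)\<^sup>2 - (x - c)\<^sup>2)) / h)"
  have \<pi>: "\<pi> h = 2 * (x - y) / \<epsilon> + h / \<epsilon> + \<delta> * (2 * (x - c) + h)"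
    "\<pi> (- h) = - 2 * (x - y) / \<epsilon> + h / \<epsilon> + \<delta> * (- 2 * (x - c) + h)"
    using h pos by (simp_all add: \<pi>_def power2_eq_square field_simps)
  have xab: "a - h \<le> x" "x \<le> b + h" using Gab[OF xz(1)] by auto
  have div: "u * (h / \<epsilon>) \<le> v / \<epsilon>" if "u * h \<le> v" for u v
    using divide_right_mono[OF that, of \<epsilon>] pos by simp
  have dl: "\<delta> * u \<le> \<delta> * v" if "u \<le> v" for u v using that pos by simp
  have \<delta>h: "0 < \<delta> * h" "0 < h / \<epsilon>" using pos h by simp_all
  have pa: "p > 0" if "y = a"
  proof -
    have "- 2 * (h / \<epsilon>) \<le> 2 * (x - y) / \<epsilon>" using that xab by (intro div) auto
    moreover have "- 2 * \<delta> * (y - c) = \<delta> * (b - a)" using that by (simp add: c_def field_simps)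
    ultimately show ?thesis using small(4) \<delta>h unfolding p_def by linarith
  qed
  have pb: "p < 0" if "y = b"
  proof -
    have "- 2 * (h / \<epsilon>) \<le> - 2 * (x - y) / \<epsilon>" using that xab by (intro div) auto
    moreover have "2 * \<delta> * (y - c) = \<delta> * (b - a)" using that by (simp add: c_def field_simps)
    ultimately show ?thesis using small(4) \<delta>h unfolding p_def by linarith
  qed
  \<comment> \<open>a missing neighbour means that \<open>x\<close> is within \<open>2 h\<close> of an end of the interval\<close>
  have out: "0 \<le> \<pi> e" if e: "e = h \<or> e = -h" and nG: "x + e \<notin> G" for e
  proof (cases "e = h")
    case True
    then have "b - 2 * h \<le> x" using grid_right_end[of x al bl r h] nG xz(1) ends h unfolding G by auto
    then have "(- 4) * h \<le> 2 * (x - y)" "b - a - 4 * h \<le> 2 * (x - c)"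
      using tys by (auto simp: c_def field_simps)
    note div[OF this(1)] dl[OF this(2)]
    moreover have "\<delta> * (b - a - 4 * h) = \<delta> * (b - a) - 4 * (\<delta> * h)"
      "\<delta> * (2 * (x - c) + h) = \<delta> * (2 * (x - c)) + \<delta> * h" "3 * \<delta> * h = 3 * (\<delta> * h)"
      "3 * h / \<epsilon> = 3 * (h / \<epsilon>)"
      by (simp_all add: algebra_simps)
    ultimately have "0 \<le> \<pi> h" using small(4) unfolding \<pi> by linarith
    then show ?thesis using True by simp
  next
    case False
    then have "x \<le> a + 2 * h" using grid_left_end[of x al bl r h] nG xz(1) ends h e unfolding G by auto
    then have "(- 4) * h \<le> - 2 * (x - y)" "b - a - 4 * h \<le> - 2 * (x - c)"
      using tys by (auto simp: c_def field_simps)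
    from div[OF this(1)] dl[OF this(2)] show ?thesis
      using small(4) False e by (auto simp add: \<pi> algebra_simps)
  qed
  have close: "\<pi> h \<le> p + \<rho>" "\<pi> (- h) \<le> - p + \<rho>"
  proof -
    have "2 * (x - c) + h + 2 * (y - c) \<le> 2 * (b - a) + 3" "- 2 * (x - c) + h - 2 * (y - c) \<le> 2 * (b - a) + 3"
      using xab tys h by (auto simp: c_def field_simps)
    note dl[OF this(1)] dl[OF this(2)]
    moreover have "\<delta> * (2 * (x - c) + h + 2 * (y - c)) = \<delta> * (2 * (x - c) + h) + 2 * \<delta> * (y - c)"
      "\<delta> * (- 2 * (x - c) + h - 2 * (y - c)) = \<delta> * (- 2 * (x - c) + h) - 2 * \<delta> * (y - c)"
      "- 2 * (x - y) / \<epsilon> = - (2 * (x - y) / \<epsilon>)"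
      by (simp_all add: algebra_simps diff_divide_distrib)
    ultimately show "\<pi> h \<le> p + \<rho>" "\<pi> (- h) \<le> - p + \<rho>"
      using small(3) unfolding \<pi> p_def by linarith+
  qed
  have nb: "k * ((W (x + e) t - W x t) / h) \<le> \<pi> e" if "x + e \<in> G" for e
  proof -
    have "k * (W (x + e) t - W x t)
      \<le> ((x + e - y)\<^sup>2 - (x - y)\<^sup>2) / \<epsilon> + \<delta> * ((x + e - c)\<^sup>2 - (x - c)\<^sup>2)"
      using max[OF that tys] by (simp add: penalty_def diff_divide_distrib algebra_simps)
    then have "k * (W (x + e) t - W x t) / h \<le> \<pi> e"
      unfolding \<pi>_def using h by (intro divide_right_mono) auto
    then show ?thesis by simp
  qed
  define D where "D = indicator G (x + h) * \<Psi>p x * (exp ((W (x + h) t - W x t) / h) - 1) +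
           indicator G (x - h) * \<Psi>m x * (exp ((W (x - h) t - W x t) / h) - 1)"
  have "(W x has_real_derivative D) (at t)"
    using dsol xz(1) t0 unfolding discrete_solution_def D_def by blast
  then have slope: "2 * (t - s) / \<mu> + \<sigma> \<le> k * D"
    by (rule time_slope_at_left_max[of _ _ _ k c \<epsilon> \<mu> \<delta> \<sigma> x y])
      (use t0 tys max[OF xz(1) _ tys(2,3)] in auto)
  have q: "2 * (t - s) / \<mu> \<le> 2 * \<tau> / \<mu>" "- (2 * (t - s) / \<mu>) \<le> 2 * \<tau> / \<mu>"
    using ts pos unfolding minus_divide_left by (auto intro!: divide_right_mono)
  have \<Psi>0: "0 \<le> \<Psi>p x" "0 \<le> \<Psi>m x" using \<Psi>[OF xz(1)] c0 by auto
  note nr = near[OF xz(1) tys(2) xy] \<Psi>[OF xz(1)] \<Phi>[OF tys(2)]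
  from k show False
  proof
    assume k: "k = 1"
    have touch: "w (y, s) + ?P x t y s \<le> w (y1, s1) + ?P x t y1 s1"
      if "y1 \<in> {a..b}" "s1 \<in> {0..T + 1}" for y1 s1
      using max[OF xz(1) tys(1) that] k by simp
    have "viscosity_supersolution a b (hamiltonian \<Phi>p \<Phi>m) w0 w"
      using sol by (simp add: viscosity_solution_def)
    from supersolution_at_touching[OF this tys(2) s0 sT touch p_def pa pb]
    have "hamiltonian \<Phi>p \<Phi>m y p \<le> 2 * (t - s) / \<mu>" .
    then have "\<Psi>p x * (exp (\<pi> h) - 1) + \<Psi>m x * (exp (\<pi> (- h)) - 1) < 2 * (t - s) / \<mu> + \<sigma>"
      using nr close q c0 by (intro gap[of "\<Phi>p y" "\<Phi>m y" _ _ _ p _ "- p"]) (auto simp: hamiltonian_def)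
    moreover have "D \<le> \<Psi>p x * (exp (\<pi> h) - 1) + \<Psi>m x * (exp (\<pi> (- h)) - 1)"
      unfolding D_def using nb k
      by (intro discrete_rhs_le[where W = "\<lambda>x. W x t", OF h(1) \<Psi>0 _ out]) auto
    ultimately show False using slope k by simp
  next
    assume k: "k = -1"
    have touch: "w (y1, s1) - ?P x t y1 s1 \<le> w (y, s) - ?P x t y s"
      if "y1 \<in> {a..b}" "s1 \<in> {0..T + 1}" for y1 s1
      using max[OF xz(1) tys(1) that] k by simp
    have "viscosity_subsolution a b (hamiltonian \<Phi>p \<Phi>m) w0 w"
      using sol by (simp add: viscosity_solution_def)
    from subsolution_at_touching[OF this tys(2) s0 sT touch p_def pa pb]
    have sub: "- (2 * (t - s) / \<mu>) \<le> hamiltonian \<Phi>p \<Phi>m y (- p)" .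
    have nb': "- \<pi> e \<le> (W (x + e) t - W x t) / h" if "x + e \<in> G" for e
      using nb[OF that] unfolding k by linarith
    have "\<Psi>p x * (exp (- \<pi> h) - 1) + \<Psi>m x * (exp (- \<pi> (- h)) - 1) \<le> D"
      unfolding D_def
      by (intro discrete_rhs_ge[where W = "\<lambda>x. W x t", OF h(1) \<Psi>0 _ out]) (use nb' in auto)
    then have "\<Phi>p y * (exp (- p) - 1) + \<Phi>m y * (exp p - 1) < - (2 * (t - s) / \<mu>) - \<sigma> + \<sigma>"
      using nr close q c0 slope k pos
      by (intro gap[of "\<Psi>p x" "\<Psi>m x" _ _ _ "- \<pi> h" _ "- \<pi> (- h)"]) auto
    with sub show False by (simp add: hamiltonian_def)
  qed
qed

section \<open>Convergence of consistent schemes\<close>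

lemma eventually_less_at_right_0:
  fixes g :: "real \<Rightarrow> real"
  assumes "isCont g 0" "g 0 < e"
  shows "\<forall>\<^sub>F h in at_right 0. g h < e"
proof -
  have "(g \<longlongrightarrow> g 0) (at_right 0)"
    using assms(1) by (simp add: isCont_def filterlim_at_split)
  then show ?thesis by (rule order_tendstoD) (rule assms)
qed

lemma at_right_witness:
  assumes "\<forall>\<^sub>F h in at_right (0::real). P h"
  obtains h where "0 < h" "P h"
proof -
  have "\<forall>\<^sub>F h in at_right (0::real). 0 < h \<and> P h"
    using eventually_at_right_less[of 0] assms by (rule eventually_conj)
  then show ?thesis
    using that eventually_happens'[OF trivial_limit_at_right_real] by blast
qed

lemma viscosity_solution_initial:
  assumes "viscosity_solution a b H w0 w" "y \<in> {a..b}"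
  shows "w (y, 0) = w0 y"
  using assms unfolding viscosity_solution_def viscosity_subsolution_def viscosity_supersolution_def
  by (auto intro: antisym)

definition clamp :: "real \<Rightarrow> real \<Rightarrow> real \<Rightarrow> real"
  where "clamp a b x = max a (min b x)"

lemma clamp:
  assumes "a \<le> b"
  shows "clamp a b x \<in> {a..b}"
    and "a - h \<le> x \<Longrightarrow> x \<le> b + h \<Longrightarrow> 0 \<le> h \<Longrightarrow> \<bar>x - clamp a b x\<bar> \<le> h"
  using assms by (auto simp: clamp_def)

text \<open>
  The planar geometry enters the convergence only through the following one-dimensional data: grids
  whose ends approach those of \<open>[a, b]\<close> at rate \<open>h\<close>, rates between two positive constants, and
  consistency of rates and initial values between nearby points of the grid and of the interval.
\<close>

locale neumann_scheme =
  fixes a b c0 M :: real and \<Phi>p \<Phi>m w0 :: "real \<Rightarrow> real" and w :: "real \<times> real \<Rightarrow> real"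
    and al bl r :: "real \<Rightarrow> real" and \<Psi>p \<Psi>m v0 :: "real \<Rightarrow> real \<Rightarrow> real"
    and W :: "real \<Rightarrow> real \<Rightarrow> real \<Rightarrow> real" and G :: "real \<Rightarrow> real set"
  defines "G \<equiv> \<lambda>h. grid (al h) (bl h) (r h) h"
  assumes ab: "a \<le> b" and c0: "0 < c0"
    and \<Phi>: "\<And>y. y \<in> {a..b} \<Longrightarrow> c0 \<le> \<Phi>p y \<and> \<Phi>p y \<le> M \<and> c0 \<le> \<Phi>m y \<and> \<Phi>m y \<le> M"
    and sol: "HJE_solution a b \<Phi>p \<Phi>m w0 w"
    and ends: "\<forall>\<^sub>F h in at_right 0. \<bar>al h - a\<bar> \<le> h \<and> \<bar>bl h - b\<bar> \<le> h"
    and \<Psi>: "\<forall>\<^sub>F h in at_right 0. \<forall>x\<in>G h. c0 \<le> \<Psi>p h x \<and> \<Psi>p h x \<le> M \<and> c0 \<le> \<Psi>m h x \<and> \<Psi>m h x \<le> M"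
    and dsol: "\<forall>\<^sub>F h in at_right 0. discrete_solution (G h) h (\<Psi>p h) (\<Psi>m h) (v0 h) (W h)"
    and consistent: "\<And>\<rho>. 0 < \<rho> \<Longrightarrow> \<exists>d>0. \<forall>\<^sub>F h in at_right 0. \<forall>x\<in>G h. \<forall>y\<in>{a..b}. \<bar>x - y\<bar> \<le> d \<longrightarrow>
      \<bar>\<Psi>p h x - \<Phi>p y\<bar> \<le> \<rho> \<and> \<bar>\<Psi>m h x - \<Phi>m y\<bar> \<le> \<rho> \<and> \<bar>v0 h x - w0 y\<bar> \<le> \<rho>"
begin

lemma grid_near:
  assumes "\<bar>al h - a\<bar> \<le> h \<and> \<bar>bl h - b\<bar> \<le> h" "x \<in> G h"
  shows "a - h \<le> x" "x \<le> b + h"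
  using assms by (auto simp: G_def grid_def)

lemma M_pos: "0 < M"
  using \<Phi>[of a] c0 ab by auto

lemma one_sided_degenerate:
  assumes eq: "a = b" and \<eta>: "0 < \<eta>" and T: "0 \<le> T" and k: "k = 1 \<or> k = -1"
  shows "\<forall>\<^sub>F h in at_right 0. \<forall>x\<in>G h. \<forall>t\<in>{0..T}. \<forall>y\<in>{a..b}. \<bar>x - y\<bar> \<le> h \<longrightarrow>
    k * (W h x t - w (y, t)) \<le> \<eta>"
proof -
  obtain d where d: "0 < d" and cons: "\<forall>\<^sub>F h in at_right 0. \<forall>x\<in>G h. \<forall>y\<in>{a..b}. \<bar>x - y\<bar> \<le> d \<longrightarrow>
      \<bar>\<Psi>p h x - \<Phi>p y\<bar> \<le> \<eta> / 2 \<and> \<bar>\<Psi>m h x - \<Phi>m y\<bar> \<le> \<eta> / 2 \<and> \<bar>v0 h x - w0 y\<bar> \<le> \<eta> / 2"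
    using consistent[of "\<eta> / 2"] \<eta> by auto
  have hd: "\<forall>\<^sub>F h in at_right 0. h < d"
    using eventually_less_at_right_0[of "\<lambda>h. h" d] d by simp
  show ?thesis
    using cons hd ends \<Psi> dsol eventually_at_right_less[of 0]
  proof eventually_elim
    case (elim h)
    show ?case
    proof (intro ballI impI)
      fix x t y assume x: "x \<in> G h" and t: "t \<in> {0..T}" and y: "y \<in> {a..b}"
      have ya: "y = a" using y eq by simp
      have near: "\<bar>x1 - a\<bar> \<le> h" if "x1 \<in> G h" for x1
        using grid_near[OF elim(3) that] eq by auto
      define C where "C = \<eta> / (2 * (T + 1))"
      have C: "0 < C" using \<eta> T by (simp add: C_def)
      have "C * t \<le> C * (T + 1)" using C t by (intro mult_left_mono) auto
      moreover have "C * (T + 1) = \<eta> / 2" using T by (simp add: C_def field_simps)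
      ultimately have Ct: "C * t \<le> \<eta> / 2" by simp
      have "k * W h x t \<le> (k * w0 a + \<eta> / 2) + 0 * (x - a)\<^sup>2 + C * t"
      proof (rule discrete_barrier[OF elim(5) _ _ k, of M a h])
        show "finite (G h)" unfolding G_def by (rule finite_grid[OF elim(6)])
        fix x1 assume x1: "x1 \<in> G h"
        show "0 \<le> \<Psi>p h x1 \<and> \<Psi>p h x1 \<le> M \<and> 0 \<le> \<Psi>m h x1 \<and> \<Psi>m h x1 \<le> M"
          using elim(4) x1 c0 by force
        show "\<bar>x1 - a\<bar> \<le> h" by (rule near[OF x1])
        have "\<bar>v0 h x1 - w0 a\<bar> \<le> \<eta> / 2"
          using elim(1,2) x1 ab near[OF x1] by force
        moreover have "k * v0 h x1 - k * w0 a \<le> \<bar>v0 h x1 - w0 a\<bar>" using k by auto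
        ultimately show "k * v0 h x1 \<le> (k * w0 a + \<eta> / 2) + 0 * (x1 - a)\<^sup>2"
          by simp
      qed (use elim x t C in auto)
      moreover have "w (y, t) = w0 a" using sol t eq ya by (simp add: HJE_solution_def)
      ultimately show "k * (W h x t - w (y, t)) \<le> \<eta>"
        using Ct by (simp add: algebra_simps)
    qed
  qed
qed

text \<open>
  The order of the choices matters: \<open>\<sigma>\<close> from \<open>\<eta>\<close>, the initial layer \<open>\<tau>\<close> and from it \<open>\<mu>\<close>, which bounds
  the time slopes by \<open>2 \<tau> / \<mu>\<close>; this bound gives the tolerance \<open>\<rho>\<close> for coefficients and slopes, from
  which \<open>\<delta>\<close> and the distance \<open>d\<close> of the doubled points and \<open>\<epsilon>\<close> are chosen; finally \<open>h \<rightarrow> 0\<close>.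
\<close>

lemma one_sided_nondegenerate:
  assumes less: "a < b" and \<eta>: "0 < \<eta>" and T: "0 \<le> T" and k: "k = 1 \<or> k = -1"
  shows "\<forall>\<^sub>F h in at_right 0. \<forall>x\<in>G h. \<forall>t\<in>{0..T}. \<forall>y\<in>{a..b}. \<bar>x - y\<bar> \<le> h \<longrightarrow>
    k * (W h x t - w (y, t)) \<le> \<eta>"
proof -
  have vs: "viscosity_solution a b (hamiltonian \<Phi>p \<Phi>m) w0 w"
    using sol less by (simp add: HJE_solution_def)
  define S where "S = {a..b} \<times> {0..T + 1}"
  have S: "compact S" "continuous_on S w"
    using vs by (auto simp: S_def viscosity_solution_def intro!: compact_Times elim!: continuous_on_subset)
  have "bounded (w ` S)"
    by (intro compact_imp_bounded compact_continuous_image S)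
  then obtain K0 where K0: "0 < K0" "\<And>z. z \<in> S \<Longrightarrow> \<bar>w z\<bar> \<le> K0"
    unfolding bounded_pos by auto
  have w0K: "\<bar>w0 y\<bar> \<le> K0" if "y \<in> {a..b}" for y
    using K0(2)[of "(y, 0)"] viscosity_solution_initial[OF vs that] that T by (simp add: S_def)
  define \<sigma> where "\<sigma> = \<eta> / (16 * (T + 1))"
  have \<sigma>: "0 < \<sigma>" "\<sigma> * T \<le> \<eta> / 16"
    using \<eta> T by (auto simp: \<sigma>_def field_simps)
  obtain d1 where d1: "0 < d1" and cons1: "\<forall>\<^sub>F h in at_right 0. \<forall>x\<in>G h. \<forall>y\<in>{a..b}. \<bar>x - y\<bar> \<le> d1 \<longrightarrow>
      \<bar>\<Psi>p h x - \<Phi>p y\<bar> \<le> \<eta> / 16 \<and> \<bar>\<Psi>m h x - \<Phi>m y\<bar> \<le> \<eta> / 16 \<and> \<bar>v0 h x - w0 y\<bar> \<le> \<eta> / 16"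
    using consistent[of "\<eta> / 16"] \<eta> by auto
  \<comment> \<open>with this \<open>K\<close> the parabola exceeds the oscillation of the initial value at distance \<open>d1\<close>\<close>
  define L where "L = b - a + 1"
  define K where "K = 2 * K0 / d1\<^sup>2"
  define C where "C = 2 * M * (exp (K * (2 * L + 1)) - 1) + 1"
  have K: "0 < K" using K0 d1 by (simp add: K_def)
  have "0 \<le> 2 * M * (exp (K * (2 * L + 1)) - 1)"
    using M_pos K less by (simp add: L_def)
  then have C: "0 < C" by (simp add: C_def)
  obtain e1 where e1: "0 < e1" "\<And>z z'. z \<in> S \<Longrightarrow> z' \<in> S \<Longrightarrow> dist z' z < e1 \<Longrightarrow> dist (w z') (w z) < \<eta> / 4"
    using compact_uniformly_continuous[OF S(2,1)] \<eta> unfolding uniformly_continuous_on_def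
    by (metis divide_pos_pos zero_less_numeral)
  define \<tau> where "\<tau> = min (1 / 2) (min (e1 / 2) (\<eta> / (16 * C)))"
  have \<tau>: "0 < \<tau>" "\<tau> < 1" "\<tau> < e1"
    using \<eta> e1 C by (auto simp: \<tau>_def)
  have "C * \<tau> \<le> C * (\<eta> / (16 * C))"
    using C by (intro mult_left_mono) (auto simp: \<tau>_def)
  then have C\<tau>: "C * \<tau> \<le> \<eta> / 16" using C by simp
  have wlayer: "\<bar>w (y, s) - w0 y\<bar> \<le> \<eta> / 4" if "y \<in> {a..b}" "0 \<le> s" "s \<le> \<tau>" for y s
  proof -
    have "dist (w (y, s)) (w (y, 0)) < \<eta> / 4"
      using that \<tau> T by (intro e1(2)) (auto simp: S_def dist_Pair_Pair dist_real_def)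
    then show ?thesis using viscosity_solution_initial[OF vs that(1)] by (simp add: dist_real_def)
  qed
  define \<mu> where "\<mu> = \<tau>\<^sup>2 / (2 * K0 + 1)"
  have \<mu>: "0 < \<mu>" "(2 * K0 + 1) * \<mu> \<le> \<tau>\<^sup>2" using \<tau> K0 by (auto simp: \<mu>_def)
  obtain \<rho> where \<rho>: "0 < \<rho>" and gap:
    "\<And>A1 B1 A2 B2 p1 m1 p2 m2 q. \<lbrakk>c0 \<le> A2; A2 \<le> M; c0 \<le> B2; B2 \<le> M; 0 \<le> A1; A1 \<le> M; 0 \<le> B1; B1 \<le> M;
       \<bar>A1 - A2\<bar> \<le> \<rho>; \<bar>B1 - B2\<bar> \<le> \<rho>; p1 \<le> p2 + \<rho>; m1 \<le> m2 + \<rho>; q \<le> 2 * \<tau> / \<mu>;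
       A2 * (exp p2 - 1) + B2 * (exp m2 - 1) \<le> q\<rbrakk>
       \<Longrightarrow> A1 * (exp p1 - 1) + B1 * (exp m1 - 1) < q + \<sigma>"
    using hamiltonian_gap[OF c0 \<sigma>(1) M_pos, of "2 * \<tau> / \<mu>"] \<tau> \<mu> by (auto simp: divide_nonneg_pos)
  obtain d2 where d2: "0 < d2" and cons2: "\<forall>\<^sub>F h in at_right 0. \<forall>x\<in>G h. \<forall>y\<in>{a..b}. \<bar>x - y\<bar> \<le> d2 \<longrightarrow>
      \<bar>\<Psi>p h x - \<Phi>p y\<bar> \<le> \<rho> \<and> \<bar>\<Psi>m h x - \<Phi>m y\<bar> \<le> \<rho> \<and> \<bar>v0 h x - w0 y\<bar> \<le> \<rho>"
    using consistent[OF \<rho>] by auto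
  obtain d3 where d3: "0 < d3" "K * d3\<^sup>2 < \<eta> / 16"
    using eventually_less_at_right_0[of "\<lambda>d. K * d\<^sup>2" "\<eta> / 16"] \<eta> by (auto elim!: at_right_witness)
  define d where "d = min d2 d3"
  have d: "0 < d" "d \<le> d2" "d \<le> d3" using d2 d3 by (auto simp: d_def)
  define \<epsilon> where "\<epsilon> = d\<^sup>2 / (2 * K0 + 1)"
  have \<epsilon>: "0 < \<epsilon>" "(2 * K0 + 1) * \<epsilon> \<le> d\<^sup>2" using d K0 by (auto simp: \<epsilon>_def)
  have "\<forall>\<^sub>F \<delta> in at_right 0. \<delta> * L\<^sup>2 < 1 / 2 \<and> 2 * \<delta> * L\<^sup>2 < \<eta> / 16 \<and> \<delta> * (2 * (b - a) + 3) < \<rho> / 2"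
    using \<eta> \<rho> by (intro eventually_conj eventually_less_at_right_0) auto
  then obtain \<delta> where \<delta>: "0 < \<delta>" "\<delta> * L\<^sup>2 < 1 / 2" "2 * \<delta> * L\<^sup>2 < \<eta> / 16" "\<delta> * (2 * (b - a) + 3) < \<rho> / 2"
    by (auto elim!: at_right_witness)
  have "\<forall>\<^sub>F h in at_right 0. h < 1 \<and> h < d1 \<and> h\<^sup>2 / \<epsilon> < 1 / 2 \<and> h\<^sup>2 / \<epsilon> < \<eta> / 16 \<and> h / \<epsilon> < \<rho> / 2
      \<and> 3 * h / \<epsilon> + 3 * \<delta> * h < \<delta> * (b - a)"
    using \<eta> \<rho> \<epsilon> \<delta> d1 less by (intro eventually_conj eventually_less_at_right_0) auto
  with cons1 cons2 ends \<Psi> dsol eventually_at_right_less[of 0] show ?thesis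
  proof eventually_elim
    case (elim h)
    have near: "a - h \<le> x \<and> x \<le> b + h" if "x \<in> G h" for x
      using grid_near[OF elim(3) that] by auto
    have layer: "k * W h x t \<le> k * w0 y + \<eta> / 4"
      if x: "x \<in> G h" and y: "y \<in> {a..b}" and xy: "\<bar>x - y\<bar> \<le> d" and t: "0 \<le> t" "t \<le> \<tau>" for x y t
    proof -
      have "k * W h x t \<le> (k * w0 y + \<eta> / 16) + K * (x - y)\<^sup>2 + C * t"
      proof (rule discrete_barrier[OF elim(5) _ _ k, of M y L])
        show "finite (G h)" unfolding G_def by (rule finite_grid[OF elim(6)])
        have "exp (K * (2 * L + h)) \<le> exp (K * (2 * L + 1))"
          using K elim by simp
        then have "2 * M * (exp (K * (2 * L + h)) - 1) \<le> 2 * M * (exp (K * (2 * L + 1)) - 1)"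
          using M_pos by (intro mult_left_mono) auto
        then show "2 * M * (exp (K * (2 * L + h)) - 1) < C" by (simp add: C_def)
        fix x1 assume x1: "x1 \<in> G h"
        show "0 \<le> \<Psi>p h x1 \<and> \<Psi>p h x1 \<le> M \<and> 0 \<le> \<Psi>m h x1 \<and> \<Psi>m h x1 \<le> M"
          using elim(4) x1 c0 by force
        show "\<bar>x1 - y\<bar> \<le> L" using near[OF x1] y elim(7) by (auto simp: L_def)
        have "\<bar>v0 h x1 - w0 y\<bar> \<le> \<eta> / 16 + K * (x1 - y)\<^sup>2"
        proof (cases "\<bar>x1 - y\<bar> \<le> d1")
          case True
          then have "\<bar>v0 h x1 - w0 y\<bar> \<le> \<eta> / 16" using elim(1) x1 y by blast
          moreover have "0 \<le> K * (x1 - y)\<^sup>2" using K by simp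
          ultimately show ?thesis by linarith
        next
          case False
          let ?u = "clamp a b x1"
          have u: "?u \<in> {a..b}" "\<bar>x1 - ?u\<bar> \<le> d1"
            using clamp(1)[OF ab, of x1] clamp(2)[OF ab, of h x1] near[OF x1] elim(6,7) by auto
          then have "\<bar>v0 h x1 - w0 ?u\<bar> \<le> \<eta> / 16" using elim(1) x1 by blast
          moreover have "\<bar>w0 ?u\<bar> \<le> K0" "\<bar>w0 y\<bar> \<le> K0" using w0K u y by auto
          moreover have "d1\<^sup>2 \<le> (x1 - y)\<^sup>2"
            using False d1 by (simp flip: abs_le_square_iff)
          then have "2 * K0 \<le> K * (x1 - y)\<^sup>2"
            using mult_left_mono[of "d1\<^sup>2" "(x1 - y)\<^sup>2" K] K d1 by (simp add: K_def)
          ultimately show ?thesis by linarith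
        qed
        then show "k * v0 h x1 \<le> (k * w0 y + \<eta> / 16) + K * (x1 - y)\<^sup>2"
          using k by (auto simp: abs_le_iff)
      qed (use elim x t K in auto)
      also have "K * (x - y)\<^sup>2 \<le> K * d3\<^sup>2"
        using xy d K by (intro mult_left_mono) (auto simp flip: abs_le_square_iff)
      also have "C * t \<le> C * \<tau>" using C t by simp
      finally show ?thesis using C\<tau> d3 \<eta> by linarith
    qed
    have h1: "h \<le> 1" "3 * h / \<epsilon> + 3 * \<delta> * h < \<delta> * (b - a)" using elim(7) by linarith+
    show ?case
    proof (intro ballI impI)
      fix x t y assume xty: "x \<in> G h" "t \<in> {0..T}" "y \<in> {a..b}" "\<bar>x - y\<bar> \<le> h"
      show "k * (W h x t - w (y, t)) \<le> \<eta>"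
      proof (rule doubling_estimate[where d = d and \<epsilon> = \<epsilon> and \<delta> = \<delta> and \<sigma> = \<sigma> and \<mu> = \<mu> and \<tau> = \<tau> and \<rho> = \<rho>, OF less _ _ T k vs _ _ _ elim(5) \<Phi> _ _ _ _ _ _ _ _ _ _ \<mu>(2) \<epsilon>(2)
            _ _ _ _ layer wlayer _ gap xty])
        show "G h = grid (al h) (bl h) (r h) h" by (simp add: G_def)
        show "h\<^sup>2 / \<epsilon> + \<delta> * (b - a + 1)\<^sup>2 \<le> 1" using elim(7) \<delta> unfolding L_def by linarith
        show "h\<^sup>2 / \<epsilon> + 2 * \<delta> * (b - a + 1)\<^sup>2 + \<sigma> * T \<le> \<eta> / 4"
          using elim(7) \<delta> \<sigma> \<eta> unfolding L_def by linarith
        show "h / \<epsilon> + \<delta> * (2 * (b - a) + 3) \<le> \<rho>" using elim(7) \<delta> by linarith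
        show "\<bar>w (y, s)\<bar> \<le> K0" if "y \<in> {a..b}" "s \<in> {0..T + 1}" for y s
          using K0(2)[of "(y, s)"] that by (simp add: S_def)
        show "\<bar>\<Psi>p h x - \<Phi>p y\<bar> \<le> \<rho> \<and> \<bar>\<Psi>m h x - \<Phi>m y\<bar> \<le> \<rho>"
          if "x \<in> G h" "y \<in> {a..b}" "\<bar>x - y\<bar> \<le> d" for x y
          using elim(2) that d by force
      qed (use h1 in \<open>simp_all add: elim less_imp_le[OF c0] \<epsilon> \<mu> \<delta> \<sigma> \<tau> d\<close>)
    qed
  qed
qed

lemma scheme_converges:
  assumes t: "0 \<le> t" and x: "\<forall>\<^sub>F h in at_right 0. x h \<in> G h"
    and lim: "(x \<longlongrightarrow> y) (at_right 0)" and y: "y \<in> {a..b}"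
  shows "((\<lambda>h. W h (x h) t) \<longlongrightarrow> w (y, t)) (at_right 0)"
proof -
  define u where "u = (\<lambda>h. clamp a b (x h))"
  have uab: "u h \<in> {a..b}" for h unfolding u_def by (rule clamp(1)[OF ab])
  have "(u \<longlongrightarrow> clamp a b y) (at_right 0)"
    unfolding u_def clamp_def by (intro tendsto_intros lim)
  then have u: "(u \<longlongrightarrow> y) (at_right 0)" using y by (simp add: clamp_def)
  have "continuous_on {a..b} (\<lambda>y. w (y, t))"
  proof (cases "a < b")
    case True
    then have "continuous_on ({a..b} \<times> {0..}) w"
      using sol by (simp add: HJE_solution_def viscosity_solution_def)
    then show ?thesis
      by (rule continuous_on_compose2) (use t in \<open>auto intro!: continuous_intros\<close>)
  next
    case False
    then have "b = a" using ab by simp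
    then show ?thesis by simp
  qed
  then have wu: "((\<lambda>h. w (u h, t)) \<longlongrightarrow> w (y, t)) (at_right 0)"
    using continuous_on_tendsto_compose[where f = "\<lambda>y. w (y, t)", OF _ u y] uab by simp
  have "((\<lambda>h. W h (x h) t - w (u h, t)) \<longlongrightarrow> 0) (at_right 0)"
  proof (rule tendstoI)
    fix e :: real assume e: "0 < e"
    have one: "\<forall>\<^sub>F h in at_right 0. \<forall>x\<in>G h. \<forall>t'\<in>{0..t}. \<forall>y\<in>{a..b}. \<bar>x - y\<bar> \<le> h \<longrightarrow>
        k * (W h x t' - w (y, t')) \<le> e / 2" if "k = 1 \<or> k = -1" for k
    proof (cases "a = b")
      case True
      then show ?thesis using e by (rule one_sided_degenerate[OF _ half_gt_zero t that])
    next
      case False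
      then have "a < b" using ab by simp
      then show ?thesis using e by (rule one_sided_nondegenerate[OF _ half_gt_zero t that])
    qed
    show "\<forall>\<^sub>F h in at_right 0. dist (W h (x h) t - w (u h, t)) 0 < e"
      using one[OF disjI1[OF refl]] one[OF disjI2[OF refl]] x ends eventually_at_right_less[of 0]
    proof eventually_elim
      case (elim h)
      have "\<bar>x h - u h\<bar> \<le> h"
        unfolding u_def using grid_near[OF elim(4,3)] elim(5) by (intro clamp(2)[OF ab]) auto
      then have "1 * (W h (x h) t - w (u h, t)) \<le> e / 2" "- 1 * (W h (x h) t - w (u h, t)) \<le> e / 2"
        using elim(1)[rule_format, OF elim(3) _ uab[of h], of t]
          elim(2)[rule_format, OF elim(3) _ uab[of h], of t] t by simp_all
      then show ?case using e by (simp add: dist_real_def)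
    qed
  qed
  from tendsto_add[OF this wu] show ?thesis by simp
qed

end

section \<open>Convergence on the segments of a planar domain\<close>

theorem theorem5p4:
  fixes \<Omega> :: "(real^2) set"
    and m n :: nat
    and \<Phi>p \<Phi>m u0 :: "real^2 \<Rightarrow> real"
    and c0 t \<alpha>0 :: real
    and x0 :: "real^2"
    and \<omega>0 :: "real \<Rightarrow> real"
    and r \<beta> :: "real \<Rightarrow> real"
    and k :: "real \<Rightarrow> int"
    and w :: "real \<times> real \<Rightarrow> real"
    and wd :: "real \<Rightarrow> real \<Rightarrow> real \<Rightarrow> real"
  assumes "open \<Omega>" and "bounded \<Omega>" and "convex \<Omega>"
    and "closure \<Omega> \<subseteq> positive_quadrant"
    and "m \<noteq> 0 \<or> n \<noteq> 0"
    and "continuous_on (closure \<Omega>) \<Phi>p" and "continuous_on (closure \<Omega>) \<Phi>m"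
    and "c0 > 0"
    and "\<forall>x\<in>closure \<Omega>. \<Phi>p x \<ge> c0" and "\<forall>x\<in>closure \<Omega>. \<Phi>m x \<ge> c0"
    and "continuous_on (closure \<Omega>) u0"
    and "t \<ge> 0"
    and "x0 \<in> closure \<Omega>"
    and "modulus \<omega>0"
    and "\<forall>\<^sub>F \<beta>' in nhds 0. seg \<Omega> x0 m n \<beta>' \<noteq> {} \<longrightarrow>
           \<bar>seg_lo \<Omega> x0 m n \<beta>' - seg_lo \<Omega> x0 m n 0\<bar> \<le> \<omega>0 \<bar>\<beta>'\<bar> \<and>
           \<bar>seg_hi \<Omega> x0 m n \<beta>' - seg_hi \<Omega> x0 m n 0\<bar> \<le> \<omega>0 \<bar>\<beta>'\<bar>"
    and "\<forall>\<^sub>F h in at_right 0. \<bar>r h\<bar> < h"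
    and "\<forall>\<^sub>F h in at_right 0. seg \<Omega> x0 m n (\<beta> h) \<noteq> {} \<and> max (\<omega>0 \<bar>\<beta> h\<bar>) \<bar>\<beta> h\<bar> \<le> h"
    and "HJE_solution (seg_lo \<Omega> x0 m n 0) (seg_hi \<Omega> x0 m n 0)
           (\<lambda>\<alpha>. \<Phi>p (line_pt x0 m n 0 \<alpha>)) (\<lambda>\<alpha>. \<Phi>m (line_pt x0 m n 0 \<alpha>))
           (\<lambda>\<alpha>. u0 (line_pt x0 m n 0 \<alpha>)) w"
    and "\<forall>\<^sub>F h in at_right 0.
           discrete_solution
             (grid (seg_lo \<Omega> x0 m n (\<beta> h)) (seg_hi \<Omega> x0 m n (\<beta> h)) (r h) h) h
             (\<lambda>x. \<Phi>p (line_pt x0 m n (\<beta> h) x)) (\<lambda>x. \<Phi>m (line_pt x0 m n (\<beta> h) x))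
             (\<lambda>x. u0 (line_pt x0 m n (\<beta> h) x)) (wd h)"
    and "\<forall>\<^sub>F h in at_right 0. r h + of_int (k h) * h
           \<in> grid (seg_lo \<Omega> x0 m n (\<beta> h)) (seg_hi \<Omega> x0 m n (\<beta> h)) (r h) h"
    and "\<alpha>0 \<in> {seg_lo \<Omega> x0 m n 0 .. seg_hi \<Omega> x0 m n 0}"
    and "((\<lambda>h. of_int (k h) * h) \<longlongrightarrow> \<alpha>0) (at_right 0)"
  shows "((\<lambda>h. wd h (r h + of_int (k h) * h) t) \<longlongrightarrow> w (\<alpha>0, t)) (at_right 0)"
proof -
  define G where "G h = grid (seg_lo \<Omega> x0 m n (\<beta> h)) (seg_hi \<Omega> x0 m n (\<beta> h)) (r h) h" for h
  let ?a = "seg_lo \<Omega> x0 m n 0" and ?b = "seg_hi \<Omega> x0 m n 0"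
  have comp: "compact (closure \<Omega>)" using \<open>bounded \<Omega>\<close> by (simp add: compact_closure)
  have "x0 = line_pt x0 m n 0 0" by (simp add: line_pt_def)
  then have "x0 \<in> seg \<Omega> x0 m n 0"
    unfolding seg_def using \<open>x0 \<in> closure \<Omega>\<close> by (metis IntI rangeI)
  then have ne0: "seg \<Omega> x0 m n 0 \<noteq> {}" by blast
  note params = seg_params_eq[OF \<open>convex \<Omega>\<close> \<open>bounded \<Omega>\<close> \<open>m \<noteq> 0 \<or> n \<noteq> 0\<close>]
  have on0: "line_pt x0 m n 0 y \<in> closure \<Omega>" if "y \<in> {?a..?b}" for y
    using params(2)[OF ne0] that by blast
  have on_seg: "line_pt x0 m n (\<beta> h) x \<in> closure \<Omega>"
    if "seg \<Omega> x0 m n (\<beta> h) \<noteq> {}" "x \<in> G h" for h x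
    using params(2)[OF that(1)] that(2) by (auto simp: G_def grid_def)
  have bdd: "\<exists>B. \<forall>z\<in>closure \<Omega>. F z \<le> B" if "continuous_on (closure \<Omega>) F" for F :: "real^2 \<Rightarrow> real"
    using continuous_attains_sup[OF comp _ that] \<open>x0 \<in> closure \<Omega>\<close> by (metis empty_iff)
  obtain Mp where Mp: "\<forall>z\<in>closure \<Omega>. \<Phi>p z \<le> Mp"
    using bdd[OF \<open>continuous_on (closure \<Omega>) \<Phi>p\<close>] by blast
  obtain Mm where Mm: "\<forall>z\<in>closure \<Omega>. \<Phi>m z \<le> Mm"
    using bdd[OF \<open>continuous_on (closure \<Omega>) \<Phi>m\<close>] by blast
  have rates: "c0 \<le> \<Phi>p z \<and> \<Phi>p z \<le> max Mp Mm \<and> c0 \<le> \<Phi>m z \<and> \<Phi>m z \<le> max Mp Mm"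
    if "z \<in> closure \<Omega>" for z
    using Mp Mm \<open>\<forall>x\<in>closure \<Omega>. \<Phi>p x \<ge> c0\<close> \<open>\<forall>x\<in>closure \<Omega>. \<Phi>m x \<ge> c0\<close> that
    by (auto simp: le_max_iff_disj)
  have \<beta>: "\<forall>\<^sub>F h in at_right 0. seg \<Omega> x0 m n (\<beta> h) \<noteq> {} \<and> \<bar>\<beta> h\<bar> \<le> h"
    using assms(17) by eventually_elim auto
  have h0: "((\<lambda>h. h) \<longlongrightarrow> 0) (at_right (0::real))" by (rule tendsto_ident_at)
  have "(\<beta> \<longlongrightarrow> 0) (at_right 0)"
    by (rule Lim_null_comparison[OF _ h0]) (use \<beta> in \<open>auto elim: eventually_mono\<close>)
  then have "\<forall>\<^sub>F h in at_right 0. seg \<Omega> x0 m n (\<beta> h) \<noteq> {} \<longrightarrow>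
           \<bar>seg_lo \<Omega> x0 m n (\<beta> h) - ?a\<bar> \<le> \<omega>0 \<bar>\<beta> h\<bar> \<and>
           \<bar>seg_hi \<Omega> x0 m n (\<beta> h) - ?b\<bar> \<le> \<omega>0 \<bar>\<beta> h\<bar>"
    by (rule eventually_compose_filterlim[OF assms(15)])
  with assms(17) have ends: "\<forall>\<^sub>F h in at_right 0.
      \<bar>seg_lo \<Omega> x0 m n (\<beta> h) - ?a\<bar> \<le> h \<and> \<bar>seg_hi \<Omega> x0 m n (\<beta> h) - ?b\<bar> \<le> h"
    by eventually_elim force
  \<comment> \<open>points of the shifted and the central segment are close, so uniform continuity gives consistency\<close>
  have near: "\<exists>d>0. \<forall>\<^sub>F h in at_right 0. \<forall>x\<in>G h. \<forall>y\<in>{?a..?b}. \<bar>x - y\<bar> \<le> d \<longrightarrow>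
      \<bar>F (line_pt x0 m n (\<beta> h) x) - F (line_pt x0 m n 0 y)\<bar> \<le> \<rho>"
    if F: "continuous_on (closure \<Omega>) F" and \<rho>: "0 < \<rho>" for F :: "real^2 \<Rightarrow> real" and \<rho>
  proof -
    obtain e where e: "0 < e" "\<And>z z'. z \<in> closure \<Omega> \<Longrightarrow> z' \<in> closure \<Omega> \<Longrightarrow> dist z' z < e \<Longrightarrow> dist (F z') (F z) < \<rho>"
      using compact_uniformly_continuous[OF F comp] \<rho> unfolding uniformly_continuous_on_def by metis
    define N P where "N = norm (reaction_vec m n)" and "P = norm (reaction_perp m n)"
    define d where "d = e / (2 * (N + 1))"
    have "0 \<le> N" by (simp add: N_def)
    then have d: "0 < d" "d * (N + 1) = e / 2"
      using e(1) by (auto simp: d_def field_simps)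
    have "\<forall>\<^sub>F h in at_right 0. h * P < e / 2"
      using e(1) by (intro eventually_less_at_right_0) auto
    then have "\<forall>\<^sub>F h in at_right 0. \<forall>x\<in>G h. \<forall>y\<in>{?a..?b}. \<bar>x - y\<bar> \<le> d \<longrightarrow>
      \<bar>F (line_pt x0 m n (\<beta> h) x) - F (line_pt x0 m n 0 y)\<bar> \<le> \<rho>"
      using \<beta>
    proof eventually_elim
      case (elim h)
      show ?case
      proof (intro ballI impI)
        fix x y assume xy: "x \<in> G h" "y \<in> {?a..?b}" "\<bar>x - y\<bar> \<le> d"
        have "line_pt x0 m n (\<beta> h) x - line_pt x0 m n 0 y
            = \<beta> h *\<^sub>R reaction_perp m n + (x - y) *\<^sub>R reaction_vec m n"
          by (simp add: line_pt_def algebra_simps)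
        then have "dist (line_pt x0 m n (\<beta> h) x) (line_pt x0 m n 0 y) \<le> \<bar>\<beta> h\<bar> * P + \<bar>x - y\<bar> * N"
          using norm_triangle_ineq[of "\<beta> h *\<^sub>R reaction_perp m n" "(x - y) *\<^sub>R reaction_vec m n"]
          by (simp add: dist_norm N_def P_def)
        also have "\<dots> \<le> h * P + d * N"
          using elim(2) xy(3) by (intro add_mono mult_right_mono) (auto simp: N_def P_def)
        also have "d * N \<le> d * (N + 1)" using d by simp
        finally have "dist (line_pt x0 m n (\<beta> h) x) (line_pt x0 m n 0 y) < e"
          using elim(1) d by simp
        from e(2)[OF on0[OF xy(2)] on_seg[OF _ xy(1)] this] elim(2)
        show "\<bar>F (line_pt x0 m n (\<beta> h) x) - F (line_pt x0 m n 0 y)\<bar> \<le> \<rho>"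
          by (simp add: dist_real_def)
      qed
    qed
    with d show ?thesis by blast
  qed
  have scheme: "neumann_scheme ?a ?b c0 (max Mp Mm) (\<lambda>\<alpha>. \<Phi>p (line_pt x0 m n 0 \<alpha>)) (\<lambda>\<alpha>. \<Phi>m (line_pt x0 m n 0 \<alpha>))
    (\<lambda>\<alpha>. u0 (line_pt x0 m n 0 \<alpha>)) w (\<lambda>h. seg_lo \<Omega> x0 m n (\<beta> h)) (\<lambda>h. seg_hi \<Omega> x0 m n (\<beta> h)) r
    (\<lambda>h x. \<Phi>p (line_pt x0 m n (\<beta> h) x)) (\<lambda>h x. \<Phi>m (line_pt x0 m n (\<beta> h) x))
    (\<lambda>h x. u0 (line_pt x0 m n (\<beta> h) x)) wd"
  proof (rule neumann_scheme.intro, fold G_def)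
    show "?a \<le> ?b" by (rule params(1)[OF ne0])
    show "0 < c0" by fact
    show "HJE_solution ?a ?b (\<lambda>\<alpha>. \<Phi>p (line_pt x0 m n 0 \<alpha>)) (\<lambda>\<alpha>. \<Phi>m (line_pt x0 m n 0 \<alpha>))
       (\<lambda>\<alpha>. u0 (line_pt x0 m n 0 \<alpha>)) w" by fact
    show "\<forall>\<^sub>F h in at_right 0. \<bar>seg_lo \<Omega> x0 m n (\<beta> h) - ?a\<bar> \<le> h \<and> \<bar>seg_hi \<Omega> x0 m n (\<beta> h) - ?b\<bar> \<le> h"
      by (rule ends)
    show "\<forall>\<^sub>F h in at_right 0. \<forall>x\<in>G h. c0 \<le> \<Phi>p (line_pt x0 m n (\<beta> h) x) \<and> \<Phi>p (line_pt x0 m n (\<beta> h) x) \<le> max Mp Mm \<and>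
        c0 \<le> \<Phi>m (line_pt x0 m n (\<beta> h) x) \<and> \<Phi>m (line_pt x0 m n (\<beta> h) x) \<le> max Mp Mm"
      using \<beta> by eventually_elim (use rates on_seg in blast)
    show "\<forall>\<^sub>F h in at_right 0. discrete_solution (G h) h (\<lambda>x. \<Phi>p (line_pt x0 m n (\<beta> h) x))
        (\<lambda>x. \<Phi>m (line_pt x0 m n (\<beta> h) x)) (\<lambda>x. u0 (line_pt x0 m n (\<beta> h) x)) (wd h)"
      unfolding G_def by fact
    show "c0 \<le> \<Phi>p (line_pt x0 m n 0 y) \<and> \<Phi>p (line_pt x0 m n 0 y) \<le> max Mp Mm \<and>
        c0 \<le> \<Phi>m (line_pt x0 m n 0 y) \<and> \<Phi>m (line_pt x0 m n 0 y) \<le> max Mp Mm" if "y \<in> {?a..?b}" for y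
      by (rule rates[OF on0[OF that]])
    fix \<rho> :: real assume \<rho>: "0 < \<rho>"
    obtain dp dm du where d: "0 < dp" "0 < dm" "0 < du" and ev:
      "\<forall>\<^sub>F h in at_right 0. \<forall>x\<in>G h. \<forall>y\<in>{?a..?b}. \<bar>x - y\<bar> \<le> dp \<longrightarrow>
        \<bar>\<Phi>p (line_pt x0 m n (\<beta> h) x) - \<Phi>p (line_pt x0 m n 0 y)\<bar> \<le> \<rho>"
      "\<forall>\<^sub>F h in at_right 0. \<forall>x\<in>G h. \<forall>y\<in>{?a..?b}. \<bar>x - y\<bar> \<le> dm \<longrightarrow>
        \<bar>\<Phi>m (line_pt x0 m n (\<beta> h) x) - \<Phi>m (line_pt x0 m n 0 y)\<bar> \<le> \<rho>"
      "\<forall>\<^sub>F h in at_right 0. \<forall>x\<in>G h. \<forall>y\<in>{?a..?b}. \<bar>x - y\<bar> \<le> du \<longrightarrow>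
        \<bar>u0 (line_pt x0 m n (\<beta> h) x) - u0 (line_pt x0 m n 0 y)\<bar> \<le> \<rho>"
      using near[OF \<open>continuous_on (closure \<Omega>) \<Phi>p\<close> \<rho>] near[OF \<open>continuous_on (closure \<Omega>) \<Phi>m\<close> \<rho>]
        near[OF \<open>continuous_on (closure \<Omega>) u0\<close> \<rho>] by blast
    show "\<exists>d>0. \<forall>\<^sub>F h in at_right 0. \<forall>x\<in>G h. \<forall>y\<in>{?a..?b}. \<bar>x - y\<bar> \<le> d \<longrightarrow>
        \<bar>\<Phi>p (line_pt x0 m n (\<beta> h) x) - \<Phi>p (line_pt x0 m n 0 y)\<bar> \<le> \<rho> \<and>
        \<bar>\<Phi>m (line_pt x0 m n (\<beta> h) x) - \<Phi>m (line_pt x0 m n 0 y)\<bar> \<le> \<rho> \<and>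
        \<bar>u0 (line_pt x0 m n (\<beta> h) x) - u0 (line_pt x0 m n 0 y)\<bar> \<le> \<rho>"
    proof (intro exI conjI)
      show "0 < min dp (min dm du)" using d by simp
      show "\<forall>\<^sub>F h in at_right 0. \<forall>x\<in>G h. \<forall>y\<in>{?a..?b}. \<bar>x - y\<bar> \<le> min dp (min dm du) \<longrightarrow>
        \<bar>\<Phi>p (line_pt x0 m n (\<beta> h) x) - \<Phi>p (line_pt x0 m n 0 y)\<bar> \<le> \<rho> \<and>
        \<bar>\<Phi>m (line_pt x0 m n (\<beta> h) x) - \<Phi>m (line_pt x0 m n 0 y)\<bar> \<le> \<rho> \<and>
        \<bar>u0 (line_pt x0 m n (\<beta> h) x) - u0 (line_pt x0 m n 0 y)\<bar> \<le> \<rho>"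
        using ev by eventually_elim simp
    qed
  qed
  have "(r \<longlongrightarrow> 0) (at_right 0)"
    by (rule Lim_null_comparison[OF _ h0]) (use assms(16) in \<open>auto elim: eventually_mono\<close>)
  from tendsto_add[OF this assms(22)]
  have lim: "((\<lambda>h. r h + of_int (k h) * h) \<longlongrightarrow> \<alpha>0) (at_right 0)" by simp
  show ?thesis
    by (rule neumann_scheme.scheme_converges[OF scheme \<open>t \<ge> 0\<close> assms(20) lim assms(21)])
qed

end
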